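(* Let $\mathcal{A}$ be a category with simplicial kernels and $\mathcal{E}$ a class of morphisms in $\mathcal{A}$ satisfying (E1)--(E4). Then the following are equivalent: (a) $(\mathcal{A},\mathcal{E})$ satisfies (E5); (b) every quasi-simplicial object in $\mathcal{A}$ is $\mathcal{E}$-Kan; (c) every simplicial object in $\mathcal{A}$ is $\mathcal{E}$-Kan.
   Context: Axioms: (E1) $\mathcal{E}$ contains all isomorphisms; (E2) pullbacks of morphisms in $\mathcal{E}$ (along arbitrary morphisms) exist in $\mathcal{A}$ and are in $\mathcal{E}$; (E3) $\mathcal{E}$ is closed under composition; (E4) if $g\circ f\in\mathcal{E}$ then $g\in\mathcal{E}$; (E5) (the $\mathcal{E}$-Mal'tsev axiom) any split epimorphism of extensions is a double extension. Here an extension is an element of $\mathcal{E}$. A split epimorphism of extensions is given by $a\colon A_1\to A_0$ and $b\colon B_1\to B_0$ in $\mathcal{E}$, morphisms $f_i\colon A_i\to B_i$ with $f_0a=bf_1$, and morphisms $s_i\colon B_i\to A_i$ with $as_1=s_0b$ and $f_is_i=1_{B_i}$ ($i=0,1$). A double extension is a commutative square $f_0a=bf_1$ in which $a,b,f_1,f_0$ and the comparison morphism $\langle a,f_1\rangle\colon A_1\to A_0\times_{B_0}B_1$ are all in $\mathcal{E}$. A simplicial kernel of morphisms $f_0,\dots,f_n\colon X\to Y$ ($n\geq 0$) is a sequence $(k_i\colon K\to X)_{0\leq i\leq n+1}$ with $f_ik_j=f_{j-1}k_i$ for $0\leq i<j\leq n+1$, universal with this property. $\mathcal{A}$ has simplicial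 kernels when all such exist. A semi-simplicial object $\mathbb{A}$ consists of objects $(A_n)_{n\geq 0}$ with faces $\partial_i\colon A_n\to A_{n-1}$ ($n\geq 1$, $0\leq i\leq n$) such that $\partial_i\partial_j=\partial_{j-1}\partial_i$ for $i<j$. A quasi-simplicial object has in addition degeneracies $\sigma_i\colon A_n\to A_{n+1}$ ($n\geq 0$, $0\leq i\leq n$) with $\partial_i\sigma_j=\sigma_{j-1}\partial_i$ if $i<j$, $\partial_i\sigma_j=1$ if $i=j$ or $i=j+1$, and $\partial_i\sigma_j=\sigma_j\partial_{i-1}$ if $i>j+1$ (no relations between degeneracies are required). It is a simplicial object when moreover $\sigma_i\sigma_j=\sigma_{j+1}\sigma_i$ for all $i\leq j$. For a semi-simplicial object $\mathbb{A}$, $n\geq 2$ and $0\leq k\leq n$, the object of $(n,k)$-horns $A(n,k)$ is an object with morphisms $a_i\colon A(n,k)\to A_{n-1}$, $i\in\{0,\dots,n\}\setminus\{k\}$, satisfying $\partial_ia_j=\partial_{j-1}a_i$ for all $i<j$ with $i,j\neq k$, universal with this property. Also $A(1,0)=A(1,1)=A_0$. $\mathbb{A}$ is $\mathcal{E}$-Kan when all $A(n,k)$ ($n\geq 1$, $0\leq k\leq n$) exist and all comparison morphisms $A_n\to A(n,k)$ (induced by the $\partial_i$, $i\neq k$) are in $\mathcal{E}$; for $n=1$ these are $\partial_0\colon A_1\to A(1,0)$ and $\partial_1\colon A_1\to A(1,1)$. *)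

theory Defs
  imports Main
begin

record ('o, 'm) cat =
  Obj :: "'o set"
  Arr :: "'m set"
  Dom :: "'m \<Rightarrow> 'o"
  Cod :: "'m \<Rightarrow> 'o"
  Ident :: "'o \<Rightarrow> 'm"
  Comp :: "'m \<Rightarrow> 'm \<Rightarrow> 'm" (infixr "\<cdot>\<index>" 70)

definition hom :: "('o, 'm, 'z) cat_scheme \<Rightarrow> 'o \<Rightarrow> 'o \<Rightarrow> 'm set" where
  "hom C X Y = {f \<in> Arr C. Dom C f = X \<and> Cod C f = Y}"

text \<open>Composition is in function order: \<open>g \<cdot>\<^bsub>C\<^esub> f\<close> is only meaningful when the
  codomain of \<open>f\<close> is the domain of \<open>g\<close>.\<close>

locale category =
  fixes C :: "('o, 'm, 'z) cat_scheme" (structure)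
  assumes Dom_Obj: "f \<in> Arr C \<Longrightarrow> Dom C f \<in> Obj C"
    and Cod_Obj: "f \<in> Arr C \<Longrightarrow> Cod C f \<in> Obj C"
    and Ident_hom: "X \<in> Obj C \<Longrightarrow> Ident C X \<in> hom C X X"
    and Comp_hom: "f \<in> hom C X Y \<Longrightarrow> g \<in> hom C Y Z \<Longrightarrow> g \<cdot> f \<in> hom C X Z"
    and Ident_left: "f \<in> hom C X Y \<Longrightarrow> Ident C Y \<cdot> f = f"
    and Ident_right: "f \<in> hom C X Y \<Longrightarrow> f \<cdot> Ident C X = f"
    and Comp_assoc: "f \<in> hom C W X \<Longrightarrow> g \<in> hom C X Y \<Longrightarrow> h \<in> hom C Y Z \<Longrightarrow>
      (h \<cdot> g) \<cdot> f = h \<cdot> (g \<cdot> f)"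

definition isomorphism :: "('o, 'm, 'z) cat_scheme \<Rightarrow> 'm \<Rightarrow> bool" where
  "isomorphism C f \<longleftrightarrow> f \<in> Arr C \<and>
     (\<exists>g \<in> hom C (Cod C f) (Dom C f).
        g \<cdot>\<^bsub>C\<^esub> f = Ident C (Dom C f) \<and> f \<cdot>\<^bsub>C\<^esub> g = Ident C (Cod C f))"

definition commutes_over ::
    "('o, 'm, 'z) cat_scheme \<Rightarrow> 'm \<Rightarrow> 'm \<Rightarrow> 'o \<Rightarrow> 'm \<Rightarrow> 'm \<Rightarrow> bool" where
  "commutes_over C f g P p q \<longleftrightarrow>
     P \<in> Obj C \<and> p \<in> hom C P (Dom C f) \<and> q \<in> hom C P (Dom C g) \<and> f \<cdot>\<^bsub>C\<^esub> p = g \<cdot>\<^bsub>C\<^esub> q"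

definition is_pullback ::
    "('o, 'm, 'z) cat_scheme \<Rightarrow> 'm \<Rightarrow> 'm \<Rightarrow> 'o \<Rightarrow> 'm \<Rightarrow> 'm \<Rightarrow> bool" where
  "is_pullback C f g P p q \<longleftrightarrow>
     f \<in> Arr C \<and> g \<in> Arr C \<and> Cod C f = Cod C g \<and> commutes_over C f g P p q \<and>
     (\<forall>Q p' q'. commutes_over C f g Q p' q' \<longrightarrow>
        (\<exists>!u. u \<in> hom C Q P \<and> p \<cdot>\<^bsub>C\<^esub> u = p' \<and> q \<cdot>\<^bsub>C\<^esub> u = q'))"


section \<open>The axioms on the class of extensions\<close>

definition E1 :: "('o, 'm, 'z) cat_scheme \<Rightarrow> 'm set \<Rightarrow> bool" where
  "E1 C E \<longleftrightarrow> (\<forall>f. isomorphism C f \<longrightarrow> f \<in> E)"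

text \<open>Universal objects are only determined up to isomorphism.  Here and below, such an
  object is required to exist, and the condition is imposed on every choice of it.\<close>

definition E2 :: "('o, 'm, 'z) cat_scheme \<Rightarrow> 'm set \<Rightarrow> bool" where
  "E2 C E \<longleftrightarrow> (\<forall>f \<in> E. \<forall>g \<in> Arr C. Cod C f = Cod C g \<longrightarrow>
     (\<exists>P p q. is_pullback C f g P p q) \<and>
     (\<forall>P p q. is_pullback C f g P p q \<longrightarrow> q \<in> E))"

definition E3 :: "('o, 'm, 'z) cat_scheme \<Rightarrow> 'm set \<Rightarrow> bool" where
  "E3 C E \<longleftrightarrow> (\<forall>f \<in> E. \<forall>g \<in> E. Cod C f = Dom C g \<longrightarrow> g \<cdot>\<^bsub>C\<^esub> f \<in> E)"

definition E4 :: "('o, 'm, 'z) cat_scheme \<Rightarrow> 'm set \<Rightarrow> bool" where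
  "E4 C E \<longleftrightarrow> (\<forall>f \<in> Arr C. \<forall>g \<in> Arr C. Cod C f = Dom C g \<longrightarrow> g \<cdot>\<^bsub>C\<^esub> f \<in> E \<longrightarrow> g \<in> E)"

text \<open>The square in question is
  \<open>a : A1 \<rightarrow> A0\<close>, \<open>b : B1 \<rightarrow> B0\<close>, \<open>f1 : A1 \<rightarrow> B1\<close>, \<open>f0 : A0 \<rightarrow> B0\<close> with \<open>f0 a = b f1\<close>;
  the splittings are \<open>s1 : B1 \<rightarrow> A1\<close> and \<open>s0 : B0 \<rightarrow> A0\<close>.\<close>

definition commutative_square ::
    "('o, 'm, 'z) cat_scheme \<Rightarrow> 'm \<Rightarrow> 'm \<Rightarrow> 'm \<Rightarrow> 'm \<Rightarrow> bool" where
  "commutative_square C a b f1 f0 \<longleftrightarrow>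
     a \<in> Arr C \<and> b \<in> Arr C \<and> f1 \<in> hom C (Dom C a) (Dom C b) \<and>
     f0 \<in> hom C (Cod C a) (Cod C b) \<and> f0 \<cdot>\<^bsub>C\<^esub> a = b \<cdot>\<^bsub>C\<^esub> f1"

definition split_epi_of_extensions ::
    "('o, 'm, 'z) cat_scheme \<Rightarrow> 'm set \<Rightarrow> 'm \<Rightarrow> 'm \<Rightarrow> 'm \<Rightarrow> 'm \<Rightarrow> 'm \<Rightarrow> 'm \<Rightarrow> bool" where
  "split_epi_of_extensions C E a b f1 f0 s1 s0 \<longleftrightarrow>
     commutative_square C a b f1 f0 \<and> a \<in> E \<and> b \<in> E \<and>
     s1 \<in> hom C (Dom C b) (Dom C a) \<and> s0 \<in> hom C (Cod C b) (Cod C a) \<and>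
     a \<cdot>\<^bsub>C\<^esub> s1 = s0 \<cdot>\<^bsub>C\<^esub> b \<and>
     f1 \<cdot>\<^bsub>C\<^esub> s1 = Ident C (Dom C b) \<and> f0 \<cdot>\<^bsub>C\<^esub> s0 = Ident C (Cod C b)"

definition double_extension ::
    "('o, 'm, 'z) cat_scheme \<Rightarrow> 'm set \<Rightarrow> 'm \<Rightarrow> 'm \<Rightarrow> 'm \<Rightarrow> 'm \<Rightarrow> bool" where
  "double_extension C E a b f1 f0 \<longleftrightarrow>
     commutative_square C a b f1 f0 \<and> a \<in> E \<and> b \<in> E \<and> f1 \<in> E \<and> f0 \<in> E \<and>
     (\<exists>P p q. is_pullback C f0 b P p q) \<and>
     (\<forall>P p q c. is_pullback C f0 b P p q \<and> c \<in> hom C (Dom C a) P \<and>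
        p \<cdot>\<^bsub>C\<^esub> c = a \<and> q \<cdot>\<^bsub>C\<^esub> c = f1 \<longrightarrow> c \<in> E)"

definition E5 :: "('o, 'm, 'z) cat_scheme \<Rightarrow> 'm set \<Rightarrow> bool" where
  "E5 C E \<longleftrightarrow> (\<forall>a b f1 f0 s1 s0.
     split_epi_of_extensions C E a b f1 f0 s1 s0 \<longrightarrow> double_extension C E a b f1 f0)"


section \<open>Simplicial kernels\<close>

definition simplicial_cone ::
    "('o, 'm, 'z) cat_scheme \<Rightarrow> nat \<Rightarrow> 'o \<Rightarrow> (nat \<Rightarrow> 'm) \<Rightarrow> 'o \<Rightarrow> (nat \<Rightarrow> 'm) \<Rightarrow> bool" where
  "simplicial_cone C n X f K k \<longleftrightarrow>
     K \<in> Obj C \<and> (\<forall>i \<le> n + 1. k i \<in> hom C K X) \<and>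
     (\<forall>i j. i < j \<and> j \<le> n + 1 \<longrightarrow> f i \<cdot>\<^bsub>C\<^esub> k j = f (j - 1) \<cdot>\<^bsub>C\<^esub> k i)"

definition is_simplicial_kernel ::
    "('o, 'm, 'z) cat_scheme \<Rightarrow> nat \<Rightarrow> 'o \<Rightarrow> (nat \<Rightarrow> 'm) \<Rightarrow> 'o \<Rightarrow> (nat \<Rightarrow> 'm) \<Rightarrow> bool" where
  "is_simplicial_kernel C n X f K k \<longleftrightarrow>
     simplicial_cone C n X f K k \<and>
     (\<forall>L l. simplicial_cone C n X f L l \<longrightarrow>
        (\<exists>!u. u \<in> hom C L K \<and> (\<forall>i \<le> n + 1. k i \<cdot>\<^bsub>C\<^esub> u = l i)))"

definition has_simplicial_kernels :: "('o, 'm, 'z) cat_scheme \<Rightarrow> bool" where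
  "has_simplicial_kernels C \<longleftrightarrow>
     (\<forall>n X Y f. X \<in> Obj C \<and> Y \<in> Obj C \<and> (\<forall>i \<le> n. f i \<in> hom C X Y) \<longrightarrow>
        (\<exists>K k. is_simplicial_kernel C n X f K k))"


section \<open>Simplicial objects\<close>

text \<open>\<open>d n i\<close> is the face \<open>\<partial>\<^sub>i : A\<^sub>n \<rightarrow> A\<^sub>n\<^sub>-\<^sub>1\<close> (for \<open>1 \<le> n\<close>, \<open>i \<le> n\<close>) and \<open>s n i\<close> is the
  degeneracy \<open>\<sigma>\<^sub>i : A\<^sub>n \<rightarrow> A\<^sub>n\<^sub>+\<^sub>1\<close> (for \<open>i \<le> n\<close>); the first index is that of the domain.
  Values at other indices are irrelevant.\<close>

definition semi_simplicial ::
    "('o, 'm, 'z) cat_scheme \<Rightarrow> (nat \<Rightarrow> 'o) \<Rightarrow> (nat \<Rightarrow> nat \<Rightarrow> 'm) \<Rightarrow> bool" where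
  "semi_simplicial C A d \<longleftrightarrow>
     (\<forall>n. A n \<in> Obj C) \<and>
     (\<forall>n i. 1 \<le> n \<and> i \<le> n \<longrightarrow> d n i \<in> hom C (A n) (A (n - 1))) \<and>
     (\<forall>n i j. 2 \<le> n \<and> i < j \<and> j \<le> n \<longrightarrow>
        d (n - 1) i \<cdot>\<^bsub>C\<^esub> d n j = d (n - 1) (j - 1) \<cdot>\<^bsub>C\<^esub> d n i)"

definition quasi_simplicial ::
    "('o, 'm, 'z) cat_scheme \<Rightarrow> (nat \<Rightarrow> 'o) \<Rightarrow> (nat \<Rightarrow> nat \<Rightarrow> 'm) \<Rightarrow> (nat \<Rightarrow> nat \<Rightarrow> 'm) \<Rightarrow> bool" where
  "quasi_simplicial C A d s \<longleftrightarrow>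
     semi_simplicial C A d \<and>
     (\<forall>n i. i \<le> n \<longrightarrow> s n i \<in> hom C (A n) (A (n + 1))) \<and>
     (\<forall>n i j. i \<le> n + 1 \<and> j \<le> n \<longrightarrow>
        (i < j \<longrightarrow> d (n + 1) i \<cdot>\<^bsub>C\<^esub> s n j = s (n - 1) (j - 1) \<cdot>\<^bsub>C\<^esub> d n i) \<and>
        (i = j \<or> i = j + 1 \<longrightarrow> d (n + 1) i \<cdot>\<^bsub>C\<^esub> s n j = Ident C (A n)) \<and>
        (i > j + 1 \<longrightarrow> d (n + 1) i \<cdot>\<^bsub>C\<^esub> s n j = s (n - 1) j \<cdot>\<^bsub>C\<^esub> d n (i - 1)))"

definition simplicial ::
    "('o, 'm, 'z) cat_scheme \<Rightarrow> (nat \<Rightarrow> 'o) \<Rightarrow> (nat \<Rightarrow> nat \<Rightarrow> 'm) \<Rightarrow> (nat \<Rightarrow> nat \<Rightarrow> 'm) \<Rightarrow> bool" where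
  "simplicial C A d s \<longleftrightarrow>
     quasi_simplicial C A d s \<and>
     (\<forall>n i j. i \<le> j \<and> j \<le> n \<longrightarrow>
        s (n + 1) i \<cdot>\<^bsub>C\<^esub> s n j = s (n + 1) (j + 1) \<cdot>\<^bsub>C\<^esub> s n i)"


section \<open>Horns and the Kan condition\<close>

definition horn_cone ::
    "('o, 'm, 'z) cat_scheme \<Rightarrow> (nat \<Rightarrow> 'o) \<Rightarrow> (nat \<Rightarrow> nat \<Rightarrow> 'm) \<Rightarrow> nat \<Rightarrow> nat \<Rightarrow>
     'o \<Rightarrow> (nat \<Rightarrow> 'm) \<Rightarrow> bool" where
  "horn_cone C A d n k H a \<longleftrightarrow>
     H \<in> Obj C \<and> (\<forall>i. i \<le> n \<and> i \<noteq> k \<longrightarrow> a i \<in> hom C H (A (n - 1))) \<and>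
     (\<forall>i j. i < j \<and> j \<le> n \<and> i \<noteq> k \<and> j \<noteq> k \<longrightarrow>
        d (n - 1) i \<cdot>\<^bsub>C\<^esub> a j = d (n - 1) (j - 1) \<cdot>\<^bsub>C\<^esub> a i)"

definition is_horn_object ::
    "('o, 'm, 'z) cat_scheme \<Rightarrow> (nat \<Rightarrow> 'o) \<Rightarrow> (nat \<Rightarrow> nat \<Rightarrow> 'm) \<Rightarrow> nat \<Rightarrow> nat \<Rightarrow>
     'o \<Rightarrow> (nat \<Rightarrow> 'm) \<Rightarrow> bool" where
  "is_horn_object C A d n k H a \<longleftrightarrow>
     horn_cone C A d n k H a \<and>
     (\<forall>L l. horn_cone C A d n k L l \<longrightarrow>
        (\<exists>!u. u \<in> hom C L H \<and> (\<forall>i. i \<le> n \<and> i \<noteq> k \<longrightarrow> a i \<cdot>\<^bsub>C\<^esub> u = l i)))"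

text \<open>In dimension 1 the horn objects are \<open>A 0\<close> and the comparison morphisms are the two
  faces of \<open>A 1\<close>.\<close>

definition Kan ::
    "('o, 'm, 'z) cat_scheme \<Rightarrow> 'm set \<Rightarrow> (nat \<Rightarrow> 'o) \<Rightarrow> (nat \<Rightarrow> nat \<Rightarrow> 'm) \<Rightarrow> bool" where
  "Kan C E A d \<longleftrightarrow>
     d 1 0 \<in> E \<and> d 1 1 \<in> E \<and>
     (\<forall>n k. 2 \<le> n \<and> k \<le> n \<longrightarrow>
        (\<exists>H a. is_horn_object C A d n k H a) \<and>
        (\<forall>H a c. is_horn_object C A d n k H a \<and> c \<in> hom C (A n) H \<and>
           (\<forall>i. i \<le> n \<and> i \<noteq> k \<longrightarrow> a i \<cdot>\<^bsub>C\<^esub> c = d n i) \<longrightarrow> c \<in> E))"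

end

theory Submission
  imports Defs
begin

text \<open>From the \<open>E\<close>-Mal'tsev axiom to the Kan condition: instead of horns alone, consider for every
  proper nonempty set \<open>I\<close> of faces the object of compatible families \<open>(a\<^sub>i)\<close>, \<open>i \<in> I\<close>, and show by
  induction on the size of \<open>I\<close> that it exists and that the comparison from \<open>A\<^sub>n\<close> is an extension.
  As \<open>I\<close> is proper and nonempty, some two consecutive indices \<open>t, t + 1\<close> meet \<open>I\<close> in a single \<open>j\<close>.
  Removing \<open>j\<close> from \<open>I\<close>, and restricting the remaining faces to the \<open>j\<close>-th face, gives two smaller
  families, whose comparisons form a square; \<open>\<partial>\<^sub>j\<close> is split in it by \<open>\<sigma>\<^sub>t\<close>, because \<open>\<sigma>\<^sub>t\<close> maps
  families avoiding \<open>t\<close> and \<open>t + 1\<close> to such families.  The axiom makes this square a double extension,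
  and its pullback is the object for \<open>I\<close>.

  Conversely, a split epimorphism of extensions \<open>(a, b, f\<^sub>1, f\<^sub>0)\<close> yields the reflexive graph on the
  domain of \<open>a\<close> with edges \<open>(u, v, w)\<close>, \<open>a u = a v\<close>, \<open>f\<^sub>1 v = f\<^sub>1 w\<close>.  Its coskeleton, built
  from simplicial kernels, is a simplicial object, and filling suitable \<open>(2, 0)\<close>-horns in it
  produces preimages under the comparison to the pullback of \<open>f\<^sub>0\<close> and \<open>b\<close>.\<close>

section \<open>Generalised elements and pullbacks\<close>

context category
begin

lemma comp_assoc:
  "f \<in> Arr C \<Longrightarrow> g \<in> Arr C \<Longrightarrow> h \<in> Arr C \<Longrightarrow> Cod C f = Dom C g \<Longrightarrow> Cod C g = Dom C h \<Longrightarrow>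
    (h \<cdot> g) \<cdot> f = h \<cdot> (g \<cdot> f)"
  by (rule Comp_assoc) (auto simp: hom_def)

lemma ident_arr: "X \<in> Obj C \<Longrightarrow> Ident C X \<in> Arr C"
  and dom_ident: "X \<in> Obj C \<Longrightarrow> Dom C (Ident C X) = X"
  and cod_ident: "X \<in> Obj C \<Longrightarrow> Cod C (Ident C X) = X"
  using Ident_hom[of X] by (auto simp: hom_def)

lemma ident_comp: "f \<in> Arr C \<Longrightarrow> Cod C f = X \<Longrightarrow> Ident C X \<cdot> f = f"
  using Ident_left by (auto simp: hom_def)

lemma hom_assoc:
  "f \<in> hom C W X \<Longrightarrow> g \<in> hom C X Y \<Longrightarrow> h \<in> hom C Y Z \<Longrightarrow> h \<cdot> (g \<cdot> f) = (h \<cdot> g) \<cdot> f"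
  by (simp add: Comp_assoc)

text \<open>Evaluates a commuting square at a generalised element \<open>x\<close>. The nested form
  \<open>g \<cdot> (f \<cdot> x)\<close> lets simplicial identities be applied to elements one face
  at a time.\<close>

lemma square_precomp:
  assumes "g \<cdot> f = g' \<cdot> f'" "f \<in> hom C X Y" "g \<in> hom C Y Z" "f' \<in> hom C X Y'" "g' \<in> hom C Y' Z"
    "x \<in> hom C W X"
  shows "g \<cdot> (f \<cdot> x) = g' \<cdot> (f' \<cdot> x)"
  using assms by (simp add: hom_assoc[of x W X])

lemma retract_precomp:
  assumes "g \<cdot> f = Ident C X" "f \<in> hom C X Y" "g \<in> hom C Y X" "x \<in> hom C W X"
  shows "g \<cdot> (f \<cdot> x) = x"
  using assms by (simp add: hom_assoc[of x W X] Ident_left)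

lemma hom_Obj: "f \<in> hom C X Y \<Longrightarrow> X \<in> Obj C" "f \<in> hom C X Y \<Longrightarrow> Y \<in> Obj C"
  using Dom_Obj Cod_Obj by (auto simp: hom_def)

lemma is_pullback_square:
  assumes "is_pullback C f g P p q"
  shows "f \<in> Arr C" "g \<in> Arr C" "Cod C f = Cod C g" "P \<in> Obj C"
    "p \<in> hom C P (Dom C f)" "q \<in> hom C P (Dom C g)" "f \<cdot> p = g \<cdot> q"
  using assms by (auto simp: is_pullback_def commutes_over_def)

lemma is_pullback_lift:
  assumes "is_pullback C f g P p q" "p' \<in> hom C Q (Dom C f)" "q' \<in> hom C Q (Dom C g)"
    "f \<cdot> p' = g \<cdot> q'"
  obtains u where "u \<in> hom C Q P" "p \<cdot> u = p'" "q \<cdot> u = q'"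
proof -
  have "commutes_over C f g Q p' q'"
    using assms hom_Obj by (auto simp: commutes_over_def)
  then show thesis using assms(1) that unfolding is_pullback_def by blast
qed

lemma is_pullback_eqI:
  assumes "is_pullback C f g P p q" "u \<in> hom C Q P" "v \<in> hom C Q P"
    "p \<cdot> u = p \<cdot> v" "q \<cdot> u = q \<cdot> v"
  shows "u = v"
proof -
  note sq = is_pullback_square[OF assms(1)]
  have "f \<cdot> (p \<cdot> u) = g \<cdot> (q \<cdot> u)"
    using sq assms(2) comp_assoc[of u p f] comp_assoc[of u q g] by (auto simp: hom_def)
  then have "commutes_over C f g Q (p \<cdot> u) (q \<cdot> u)"
    using sq assms(2) hom_Obj by (auto simp: commutes_over_def intro: Comp_hom)
  then have "\<exists>!w. w \<in> hom C Q P \<and> p \<cdot> w = p \<cdot> u \<and> q \<cdot> w = q \<cdot> u"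
    using assms(1) unfolding is_pullback_def by blast
  then show ?thesis using assms(2-5) by (metis (no_types))
qed

end

section \<open>Closure properties of the class of extensions\<close>

locale extensions = category C for C :: "('o, 'm, 'z) cat_scheme" (structure) +
  fixes E :: "'m set"
  assumes E_Arr: "E \<subseteq> Arr C"
    and E1: "E1 C E" and E2: "E2 C E" and E3: "E3 C E" and E4: "E4 C E"
begin

text \<open>(E1) puts the identity \<open>f \<cdot> s\<close> into \<open>E\<close>, and (E4)
  discards the section.\<close>

lemma split_epi_in_E:
  assumes "f \<in> hom C X Y" "s \<in> hom C Y X" "f \<cdot> s = Ident C Y"
  shows "f \<in> E"
proof -
  have Y: "Y \<in> Obj C" using assms(1) hom_Obj by blast
  have "isomorphism C (Ident C Y)"
    using Y Ident_hom[OF Y] ident_comp[of "Ident C Y" Y]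
    by (auto simp: isomorphism_def dom_ident cod_ident hom_def)
  then have "f \<cdot> s \<in> E" using E1 assms(3) by (simp add: E1_def)
  then show ?thesis using E4 assms by (auto simp: E4_def hom_def)
qed

lemma comp_in_E: "f \<in> E \<Longrightarrow> g \<in> E \<Longrightarrow> Cod C f = Dom C g \<Longrightarrow> g \<cdot> f \<in> E"
  using E3 by (auto simp: E3_def)

lemma comp_in_E_cancel:
  "g \<cdot> f \<in> E \<Longrightarrow> f \<in> Arr C \<Longrightarrow> g \<in> Arr C \<Longrightarrow> Cod C f = Dom C g \<Longrightarrow> g \<in> E"
  using E4 by (auto simp: E4_def)

lemma pullback_of_E:
  assumes "f \<in> hom C X Z" "f \<in> E" "g \<in> hom C Y Z"
  obtains P p q where "is_pullback C f g P p q" "p \<in> hom C P X" "q \<in> hom C P Y" "f \<cdot> p = g \<cdot> q"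
    "q \<in> E"
proof -
  have g: "g \<in> Arr C" "Cod C f = Cod C g" using assms by (auto simp: hom_def)
  then obtain P p q where P: "is_pullback C f g P p q"
    using E2 assms(2) unfolding E2_def by blast
  moreover have "q \<in> E" using E2 assms(2) g P unfolding E2_def by blast
  ultimately show thesis
    using is_pullback_square[OF P] assms by (intro that) (auto simp: hom_def)
qed

end

section \<open>Partial horns\<close>

text \<open>With \<open>I = {..n} - {k}\<close> this is a cone over an \<open>(n, k)\<close>-horn;
  arbitrary index sets allow induction on the size of \<open>I\<close>. For \<open>n = 1\<close> the
  matching condition mentions \<open>d 0\<close>, whose values are arbitrary, so there it is
  meaningful only for families with at most one index.\<close>

definition face_cone ::
    "('o, 'm, 'z) cat_scheme \<Rightarrow> (nat \<Rightarrow> 'o) \<Rightarrow> (nat \<Rightarrow> nat \<Rightarrow> 'm) \<Rightarrow> nat \<Rightarrow> nat set \<Rightarrow>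
     'o \<Rightarrow> (nat \<Rightarrow> 'm) \<Rightarrow> bool" where
  "face_cone C A d n I L l \<longleftrightarrow>
     L \<in> Obj C \<and> (\<forall>i\<in>I. l i \<in> hom C L (A (n - 1))) \<and>
     (\<forall>i\<in>I. \<forall>j\<in>I. i < j \<longrightarrow> d (n - 1) i \<cdot>\<^bsub>C\<^esub> l j = d (n - 1) (j - 1) \<cdot>\<^bsub>C\<^esub> l i)"

definition is_partial_horn ::
    "('o, 'm, 'z) cat_scheme \<Rightarrow> (nat \<Rightarrow> 'o) \<Rightarrow> (nat \<Rightarrow> nat \<Rightarrow> 'm) \<Rightarrow> nat \<Rightarrow> nat set \<Rightarrow>
     'o \<Rightarrow> (nat \<Rightarrow> 'm) \<Rightarrow> bool" where
  "is_partial_horn C A d n I H a \<longleftrightarrow>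
     face_cone C A d n I H a \<and>
     (\<forall>L l. face_cone C A d n I L l \<longrightarrow>
        (\<exists>!u. u \<in> hom C L H \<and> (\<forall>i\<in>I. a i \<cdot>\<^bsub>C\<^esub> u = l i)))"

lemma is_horn_object_iff_partial:
  "is_horn_object C A d n k H a \<longleftrightarrow> is_partial_horn C A d n ({..n} - {k}) H a"
proof -
  have cone: "horn_cone C A d n k L l \<longleftrightarrow> face_cone C A d n ({..n} - {k}) L l" for L l
    by (auto simp: horn_cone_def face_cone_def)
  show ?thesis
    by (simp add: is_horn_object_def is_partial_horn_def cone Ball_def)
qed

text \<open>Otherwise membership in \<open>I\<close> would be constant along
  \<open>0, ..., n\<close>, making \<open>I\<close> empty or everything.\<close>

lemma boundary_index:
  assumes "I \<subseteq> {..n}" "I \<noteq> {}" "I \<noteq> {..n}"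
  obtains t j where "t < n" "I \<inter> {t, Suc t} = {j}"
proof -
  have "\<exists>t<n. (t \<in> I) \<noteq> (Suc t \<in> I)"
  proof (rule ccontr)
    assume "\<not> ?thesis"
    then have step: "t < n \<Longrightarrow> (t \<in> I) = (Suc t \<in> I)" for t by blast
    have "t \<le> n \<Longrightarrow> (t \<in> I) = (0 \<in> I)" for t
      by (induction t) (use step in auto)
    then show False using assms by auto
  qed
  then obtain t where t: "t < n" "(t \<in> I) \<noteq> (Suc t \<in> I)" by blast
  show thesis
  proof (cases "t \<in> I")
    case True then show thesis using t that[of t t] by auto
  next
    case False then show thesis using t that[of t "Suc t"] by auto
  qed
qed

context category
begin

lemma is_partial_horn_lift:
  assumes "is_partial_horn C A d n I H a" "face_cone C A d n I L l"
  obtains u where "u \<in> hom C L H" "\<And>i. i \<in> I \<Longrightarrow> a i \<cdot> u = l i"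
  using assms unfolding is_partial_horn_def by blast

lemma is_partial_horn_proj:
  assumes "is_partial_horn C A d n I H a"
  shows "H \<in> Obj C" "i \<in> I \<Longrightarrow> a i \<in> hom C H (A (n - 1))"
    "i \<in> I \<Longrightarrow> j \<in> I \<Longrightarrow> i < j \<Longrightarrow> d (n - 1) i \<cdot> a j = d (n - 1) (j - 1) \<cdot> a i"
  using assms by (auto simp: is_partial_horn_def face_cone_def)

end

section \<open>Simplicial identities on generalised elements\<close>

locale semi_simplicial_object = category C for C :: "('o, 'm, 'z) cat_scheme" (structure) +
  fixes A :: "nat \<Rightarrow> 'o" and d :: "nat \<Rightarrow> nat \<Rightarrow> 'm"
  assumes semi: "semi_simplicial C A d"
begin

lemma obj: "A n \<in> Obj C"
  using semi by (auto simp: semi_simplicial_def)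

lemma face_hom: "i \<le> Suc n \<Longrightarrow> d (Suc n) i \<in> hom C (A (Suc n)) (A n)"
proof -
  assume "i \<le> Suc n"
  moreover have "1 \<le> Suc n \<and> i \<le> Suc n \<longrightarrow> d (Suc n) i \<in> hom C (A (Suc n)) (A (Suc n - 1))"
    using semi unfolding semi_simplicial_def by blast
  ultimately show ?thesis by simp
qed

lemma face_comp: "x \<in> hom C L (A (Suc n)) \<Longrightarrow> i \<le> Suc n \<Longrightarrow> d (Suc n) i \<cdot> x \<in> hom C L (A n)"
  using face_hom Comp_hom by blast

lemma face_face:
  assumes "i < j" "j \<le> Suc (Suc n)"
  shows "d (Suc n) i \<cdot> d (Suc (Suc n)) j = d (Suc n) (j - 1) \<cdot> d (Suc (Suc n)) i"
proof -
  have "2 \<le> Suc (Suc n) \<and> i < j \<and> j \<le> Suc (Suc n) \<longrightarrow>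
      d (Suc (Suc n) - 1) i \<cdot> d (Suc (Suc n)) j = d (Suc (Suc n) - 1) (j - 1) \<cdot> d (Suc (Suc n)) i"
    using semi unfolding semi_simplicial_def by blast
  then show ?thesis using assms by simp
qed

lemma face_face_elem:
  assumes "x \<in> hom C L (A (Suc (Suc n)))" "i < j" "j \<le> Suc (Suc n)"
  shows "d (Suc n) i \<cdot> (d (Suc (Suc n)) j \<cdot> x) = d (Suc n) (j - 1) \<cdot> (d (Suc (Suc n)) i \<cdot> x)"
  by (rule square_precomp[OF face_face face_hom face_hom face_hom face_hom assms(1)])
    (use assms in auto)


text \<open>The last hypothesis deals with dimension 1, where matching would involve the arbitrary
  values \<open>d 0\<close>; a family with at most one index has no matching condition.\<close>

lemma face_cone_precomp:
  assumes "face_cone C A d n I H a" "u \<in> hom C L H" "I \<subseteq> {..n}"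
    "n = Suc 0 \<longrightarrow> (\<forall>i\<in>I. \<forall>j\<in>I. i = j)"
  shows "face_cone C A d n I L (\<lambda>i. a i \<cdot> u)"
  unfolding face_cone_def
proof (intro conjI ballI impI)
  show "L \<in> Obj C" using assms(2) hom_Obj by blast
  show "a i \<cdot> u \<in> hom C L (A (n - 1))" if "i \<in> I" for i
    using assms(1,2) that by (auto simp: face_cone_def intro: Comp_hom)
  show "d (n - 1) i \<cdot> (a j \<cdot> u) = d (n - 1) (j - 1) \<cdot> (a i \<cdot> u)"
    if ij: "i \<in> I" "j \<in> I" "i < j" for i j
  proof -
    have j: "j \<le> n" using ij assms(3) by auto
    then obtain m where n: "n = Suc (Suc m)"
      using assms(4) ij by (cases n; cases "n - 1"; auto)
    have "a i \<in> hom C H (A (Suc m))" "a j \<in> hom C H (A (Suc m))"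
      "d (Suc m) i \<cdot> a j = d (Suc m) (j - 1) \<cdot> a i"
      using assms(1) ij n by (auto simp: face_cone_def)
    then show ?thesis
      using square_precomp[of "d (Suc m) i" "a j" "d (Suc m) (j - 1)" "a i" H "A (Suc m)" "A m"]
        face_hom[of i m] face_hom[of "j - 1" m] assms(2) ij j n by simp
  qed
qed

lemma is_partial_horn_eqI:
  assumes "is_partial_horn C A d n I H a" "u \<in> hom C L H" "v \<in> hom C L H" "I \<subset> {..n}"
    "\<And>i. i \<in> I \<Longrightarrow> a i \<cdot> u = a i \<cdot> v"
  shows "u = v"
proof -
  \<comment> \<open>A proper subset of \<open>{0, 1}\<close> has at most one element, so no matching
    condition arises in dimension 1.\<close>
  have "\<forall>i\<in>I. \<forall>j\<in>I. i = j" if "n = Suc 0"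
  proof (intro ballI)
    fix i j assume ij: "i \<in> I" "j \<in> I"
    show "i = j"
    proof (rule ccontr)
      assume "i \<noteq> j"
      moreover have "i \<le> Suc 0" "j \<le> Suc 0" using ij assms(4) that by auto
      ultimately have "{0, Suc 0} \<subseteq> I" using ij by (cases i; cases j; auto)
      moreover have "{..n} \<subseteq> {0, Suc 0}" using that by auto
      ultimately show False using assms(4) by blast
    qed
  qed
  then have "face_cone C A d n I L (\<lambda>i. a i \<cdot> u)"
    using assms(1,2,4) by (intro face_cone_precomp[of n I H a u L]) (simp_all add: is_partial_horn_def)
  then have "\<exists>!w. w \<in> hom C L H \<and> (\<forall>i\<in>I. a i \<cdot> w = a i \<cdot> u)"
    using assms(1) unfolding is_partial_horn_def by blast
  then show ?thesis using assms(2,3,5) by (metis (no_types))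
qed

end

locale quasi_simplicial_object = category C for C :: "('o, 'm, 'z) cat_scheme" (structure) +
  fixes A :: "nat \<Rightarrow> 'o" and d :: "nat \<Rightarrow> nat \<Rightarrow> 'm" and s :: "nat \<Rightarrow> nat \<Rightarrow> 'm"
  assumes quasi: "quasi_simplicial C A d s"
begin

sublocale semi_simplicial_object C A d
  using quasi by unfold_locales (simp add: quasi_simplicial_def)

lemma degen_hom: "i \<le> n \<Longrightarrow> s n i \<in> hom C (A n) (A (Suc n))"
  using quasi unfolding quasi_simplicial_def Suc_eq_plus1 by blast

lemma degen_comp: "x \<in> hom C L (A n) \<Longrightarrow> i \<le> n \<Longrightarrow> s n i \<cdot> x \<in> hom C L (A (Suc n))"
  using degen_hom Comp_hom by blast

lemma face_degen:
  assumes "j \<le> n"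
  shows "i < j \<Longrightarrow> d (Suc n) i \<cdot> s n j = s (n - 1) (j - 1) \<cdot> d n i"
    and "i = j \<or> i = Suc j \<Longrightarrow> d (Suc n) i \<cdot> s n j = Ident C (A n)"
    and "Suc j < i \<Longrightarrow> i \<le> Suc n \<Longrightarrow> d (Suc n) i \<cdot> s n j = s (n - 1) j \<cdot> d n (i - 1)"
proof -
  have *: "i \<le> n + 1 \<and> j \<le> n \<longrightarrow>
        (i < j \<longrightarrow> d (n + 1) i \<cdot> s n j = s (n - 1) (j - 1) \<cdot> d n i) \<and>
        (i = j \<or> i = j + 1 \<longrightarrow> d (n + 1) i \<cdot> s n j = Ident C (A n)) \<and>
        (i > j + 1 \<longrightarrow> d (n + 1) i \<cdot> s n j = s (n - 1) j \<cdot> d n (i - 1))"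
    using quasi unfolding quasi_simplicial_def by blast
  show "i < j \<Longrightarrow> d (Suc n) i \<cdot> s n j = s (n - 1) (j - 1) \<cdot> d n i"
    and "i = j \<or> i = Suc j \<Longrightarrow> d (Suc n) i \<cdot> s n j = Ident C (A n)"
    and "Suc j < i \<Longrightarrow> i \<le> Suc n \<Longrightarrow> d (Suc n) i \<cdot> s n j = s (n - 1) j \<cdot> d n (i - 1)"
    using * assms by auto
qed

lemma face_degen_elem_less:
  assumes "x \<in> hom C L (A (Suc n))" "j \<le> n" "i \<le> j"
  shows "d (Suc (Suc n)) i \<cdot> (s (Suc n) (Suc j) \<cdot> x) = s n j \<cdot> (d (Suc n) i \<cdot> x)"
proof -
  have "d (Suc (Suc n)) i \<cdot> s (Suc n) (Suc j) = s n j \<cdot> d (Suc n) i"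
    using face_degen(1)[of "Suc j" "Suc n" i] assms by simp
  then show ?thesis
    by (rule square_precomp[OF _ degen_hom face_hom face_hom degen_hom assms(1)]) (use assms in simp_all)
qed

lemma face_degen_elem_eq:
  assumes "x \<in> hom C L (A n)" "j \<le> n" "i = j \<or> i = Suc j"
  shows "d (Suc n) i \<cdot> (s n j \<cdot> x) = x"
  by (rule retract_precomp[OF face_degen(2) degen_hom face_hom assms(1)]) (use assms in auto)

lemma face_degen_elem_greater:
  assumes "x \<in> hom C L (A (Suc n))" "j < i" "i \<le> Suc n"
  shows "d (Suc (Suc n)) (Suc i) \<cdot> (s (Suc n) j \<cdot> x) = s n j \<cdot> (d (Suc n) i \<cdot> x)"
proof -
  have "d (Suc (Suc n)) (Suc i) \<cdot> s (Suc n) j = s n j \<cdot> d (Suc n) i"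
    using face_degen(3)[of j "Suc n" "Suc i"] assms by simp
  then show ?thesis
    by (rule square_precomp[OF _ degen_hom face_hom face_hom degen_hom assms(1)]) (use assms in simp_all)
qed

end

section \<open>Faces and degeneracies of compatible families\<close>

definition coface :: "nat \<Rightarrow> nat \<Rightarrow> nat" where
  "coface j i = (if i < j then i else Suc i)"

text \<open>With \<open>i' = coface j i\<close>, the face \<open>\<partial>\<^sub>i\<close> of the \<open>j\<close>-th face of a simplex is the
  \<open>coface_dual j i\<close>-th face of its \<open>i'\<close>-th face.\<close>

definition coface_dual :: "nat \<Rightarrow> nat \<Rightarrow> nat" where
  "coface_dual j i = (if i < j then j - 1 else j)"

lemma coface_neq: "coface j i \<noteq> j"
  by (simp add: coface_def)

lemma inj_coface: "inj (coface j)"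
  by (rule injI) (auto simp: coface_def split: if_splits)

text \<open>The matching condition distinguishes the smaller from the larger index;
  \<open>coface\<close> and \<open>coface_dual\<close> merge the cases of \<open>j\<close> being
  larger or smaller into one equation.\<close>

lemma face_cone_coface:
  assumes "face_cone C A d n I L l" "i \<in> coface j -` I" "j \<in> I"
  shows "d (n - 1) i \<cdot>\<^bsub>C\<^esub> l j = d (n - 1) (coface_dual j i) \<cdot>\<^bsub>C\<^esub> l (coface j i)"
proof (cases "i < j")
  case True
  then show ?thesis using assms by (simp add: face_cone_def coface_def coface_dual_def)
next
  case False
  then have "j < Suc i" "Suc i \<in> I" using assms(2) by (auto simp: coface_def)
  then have "d (n - 1) j \<cdot>\<^bsub>C\<^esub> l (Suc i) = d (n - 1) (Suc i - 1) \<cdot>\<^bsub>C\<^esub> l j"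
    using assms(1,3) unfolding face_cone_def by blast
  then show ?thesis using False by (simp add: coface_def coface_dual_def)
qed

lemma face_cone_subset: "face_cone C A d n I L l \<Longrightarrow> J \<subseteq> I \<Longrightarrow> face_cone C A d n J L l"
  unfolding face_cone_def by blast

context semi_simplicial_object
begin

lemma face_cone_faces: "n = Suc m \<Longrightarrow> m \<noteq> 0 \<Longrightarrow> face_cone C A d n {..n} (A n) (d n)"
  using face_face[of _ _ "m - 1"] face_hom[of _ m] by (auto simp: face_cone_def obj)

text \<open>These are the faces that a \<open>j\<close>-th component would need, as prescribed by
  the other components. They match because the matching of \<open>l\<close> fits between two
  simplicial identities, wherever \<open>j\<close> lies relative to \<open>i < k\<close>. Properness
  of \<open>K\<close> excludes pairs of indices in dimension 1.\<close>

lemma face_cone_face: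
  assumes cone: "face_cone C A d (Suc (Suc m)) I L l" and "K \<subset> {..Suc m}" "K \<subseteq> coface j -` I"
    "I \<subseteq> {..Suc (Suc m)}" "j \<le> Suc (Suc m)"
  shows "face_cone C A d (Suc m) K L (\<lambda>i. d (Suc m) (coface_dual j i) \<cdot> l (coface j i))"
  unfolding face_cone_def
proof (intro conjI ballI impI)
  show "L \<in> Obj C" using cone by (simp add: face_cone_def)
  have l: "i \<in> I \<Longrightarrow> l i \<in> hom C L (A (Suc m))" for i
    using cone by (simp add: face_cone_def)
  have ll: "i \<in> I \<Longrightarrow> k \<in> I \<Longrightarrow> i < k \<Longrightarrow> d (Suc m) i \<cdot> l k = d (Suc m) (k - 1) \<cdot> l i" for i k
    using cone by (simp add: face_cone_def)
  show "d (Suc m) (coface_dual j i) \<cdot> l (coface j i) \<in> hom C L (A (Suc m - 1))" if "i \<in> K" for i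
  proof -
    have "coface j i \<in> I" "i \<le> Suc m" using that assms(2,3) by auto
    moreover have "coface_dual j i \<le> Suc m"
      using \<open>i \<le> Suc m\<close> assms(5) by (auto simp: coface_dual_def)
    ultimately show ?thesis using face_comp[OF l] by simp
  qed
  show "d (Suc m - 1) i \<cdot> (d (Suc m) (coface_dual j k) \<cdot> l (coface j k)) =
      d (Suc m - 1) (k - 1) \<cdot> (d (Suc m) (coface_dual j i) \<cdot> l (coface j i))"
    if ik: "i \<in> K" "k \<in> K" "i < k" for i k
  proof -
    have k: "k \<le> Suc m" using ik assms(2) by auto
    have I: "coface j i \<in> I" "coface j k \<in> I" using ik assms(3) by auto
    have "m \<noteq> 0"
    proof
      assume "m = 0"
      then have "i = 0" "k = Suc 0" using ik k by auto
      then have "{..Suc m} \<subseteq> K" using ik \<open>m = 0\<close> by (auto simp: le_Suc_eq)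
      then show False using assms(2) by blast
    qed
    then obtain p where m: "m = Suc p" by (cases m) auto
    note ff = face_face_elem[where n = p and L = L, folded m]
    consider (a) "k < j" | (b) "i < j" "j \<le> k" | (c) "j \<le> i" by linarith
    then show ?thesis
    proof cases
      case a
      have "d m i \<cdot> (d (Suc m) (j - 1) \<cdot> l k) = d m (j - 1 - 1) \<cdot> (d (Suc m) i \<cdot> l k)"
        using a ik I assms(5) m by (intro ff l) (auto simp: coface_def)
      also have "\<dots> = d m (j - 1 - 1) \<cdot> (d (Suc m) (k - 1) \<cdot> l i)"
        using ll a ik I by (simp add: coface_def)
      also have "\<dots> = d m (k - 1) \<cdot> (d (Suc m) (j - 1) \<cdot> l i)"
        using a ik I assms(5) m by (intro ff[symmetric] l) (auto simp: coface_def)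
      finally show ?thesis using a ik by (simp add: coface_def coface_dual_def)
    next
      case b
      have "d m i \<cdot> (d (Suc m) j \<cdot> l (Suc k)) = d m (j - 1) \<cdot> (d (Suc m) i \<cdot> l (Suc k))"
        using b ik I k m by (intro ff l) (auto simp: coface_def)
      also have "\<dots> = d m (j - 1) \<cdot> (d (Suc m) k \<cdot> l i)"
        using ll[of i "Suc k"] b ik I by (simp add: coface_def)
      also have "\<dots> = d m (k - 1) \<cdot> (d (Suc m) (j - 1) \<cdot> l i)"
        using b ik I k m by (intro ff l) (auto simp: coface_def)
      finally show ?thesis using b ik by (simp add: coface_def coface_dual_def)
    next
      case c
      have "d m i \<cdot> (d (Suc m) j \<cdot> l (Suc k)) = d m j \<cdot> (d (Suc m) (Suc i) \<cdot> l (Suc k))"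
        using c ik I k m ff[of "l (Suc k)" j "Suc i"] l by (auto simp: coface_def)
      also have "\<dots> = d m j \<cdot> (d (Suc m) k \<cdot> l (Suc i))"
        using ll[of "Suc i" "Suc k"] c ik I by (simp add: coface_def)
      also have "\<dots> = d m (k - 1) \<cdot> (d (Suc m) j \<cdot> l (Suc i))"
        using c ik I k m by (intro ff l) (auto simp: coface_def)
      finally show ?thesis using c ik by (simp add: coface_def coface_dual_def)
    qed
  qed
qed

end

context quasi_simplicial_object
begin

text \<open>The family consists of the faces of the \<open>t\<close>-th degeneracy of a simplex with
  faces \<open>l\<close>. A face with index other than \<open>t\<close> and \<open>Suc t\<close> is
  a degeneracy of a face of the simplex, hence expressible by \<open>l\<close>; the faces
  \<open>t\<close> and \<open>Suc t\<close> would be the simplex itself, so \<open>J\<close> avoids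
  them.\<close>

lemma face_cone_degen:
  assumes cone: "face_cone C A d (Suc m) K L l" and "J \<subseteq> {..Suc (Suc m)}" "t \<notin> J" "Suc t \<notin> J"
    "t \<le> Suc m" "\<And>i. i \<in> J \<Longrightarrow> i < t \<Longrightarrow> i \<in> K" "\<And>i. i \<in> J \<Longrightarrow> Suc t < i \<Longrightarrow> i - 1 \<in> K"
  shows "face_cone C A d (Suc (Suc m)) J L
    (\<lambda>i. if i < t then s m (t - 1) \<cdot> l i else s m t \<cdot> l (i - 1))"
    (is "face_cone _ _ _ _ _ _ ?S")
  unfolding face_cone_def
proof (intro conjI ballI impI)
  show "L \<in> Obj C" using cone by (simp add: face_cone_def)
  have l: "i \<in> K \<Longrightarrow> l i \<in> hom C L (A m)" for i
    using cone by (simp add: face_cone_def)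
  have ll: "i \<in> K \<Longrightarrow> k \<in> K \<Longrightarrow> i < k \<Longrightarrow> d m i \<cdot> l k = d m (k - 1) \<cdot> l i" for i k
    using cone by (simp add: face_cone_def)
  have split: "i < t \<or> Suc t < i" if "i \<in> J" for i
    using that assms(3,4) by (metis Suc_lessI linorder_neqE_nat)
  show "?S i \<in> hom C L (A (Suc (Suc m) - 1))" if "i \<in> J" for i
  proof (cases "i < t")
    case True
    then show ?thesis using assms(5,6) that by (auto intro!: degen_comp l)
  next
    case False
    then have "Suc t < i" "i \<le> Suc (Suc m)" using split[OF that] assms(2) that by auto
    then show ?thesis using False assms(7) that by (auto intro!: degen_comp l)
  qed
  show "d (Suc (Suc m) - 1) i \<cdot> ?S k = d (Suc (Suc m) - 1) (k - 1) \<cdot> ?S i"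
    if ik: "i \<in> J" "k \<in> J" "i < k" for i k
  proof -
    have k: "k \<le> Suc (Suc m)" using ik assms(2) by auto
    \<comment> \<open>Two distinct indices outside \<open>{t, Suc t}\<close> do not fit into
      \<open>{0, 1, 2}\<close>, so \<open>d m\<close> consists of actual faces.\<close>
    have "m \<noteq> 0" using split[OF ik(1)] split[OF ik(2)] ik(3) k assms(5) by presburger
    then obtain p where m: "m = Suc p" by (cases m) auto
    note lo = face_degen_elem_less[where n = p and L = L, folded m]
    note hi = face_degen_elem_greater[where n = p and L = L, folded m]
    consider (a) "k < t" | (b) "i < t" "Suc t < k" | (c) "Suc t < i"
      using split[OF ik(1)] split[OF ik(2)] ik(3) by linarith
    then show ?thesis
    proof cases
      case a
      define r where "r = t - 2"
      have t: "t = Suc (Suc r)" using a ik by (simp add: r_def)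
      have K: "i \<in> K" "k \<in> K" using a ik assms(6) by auto
      have "d (Suc m) i \<cdot> (s m (Suc r) \<cdot> l k) = s p r \<cdot> (d m i \<cdot> l k)"
        using a ik t assms(5) m K by (intro lo l) auto
      also have "\<dots> = s p r \<cdot> (d m (k - 1) \<cdot> l i)" using ll K ik by simp
      also have "\<dots> = d (Suc m) (k - 1) \<cdot> (s m (Suc r) \<cdot> l i)"
        using a ik t assms(5) m K by (intro lo[symmetric] l) auto
      finally show ?thesis using a ik t by simp
    next
      case b
      obtain r where t: "t = Suc r" using b by (cases t) auto
      obtain q where kq: "k = Suc (Suc q)" using b by (cases k; cases "k - 1"; auto)
      have K: "i \<in> K" "Suc q \<in> K" using b ik assms(6,7)[of k] kq assms(6)[of i] by auto
      have "d (Suc m) i \<cdot> (s m (Suc r) \<cdot> l (Suc q)) = s p r \<cdot> (d m i \<cdot> l (Suc q))"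
        using b ik t k kq m K by (intro lo l) auto
      also have "\<dots> = s p r \<cdot> (d m q \<cdot> l i)" using ll[of i "Suc q"] K b kq t by simp
      also have "\<dots> = d (Suc m) (Suc q) \<cdot> (s m r \<cdot> l i)"
        using b t k kq m K by (intro hi[symmetric] l) auto
      finally show ?thesis using b ik t kq by simp
    next
      case c
      obtain q where kq: "k = Suc (Suc q)" using c ik by (cases k; cases "k - 1"; auto)
      obtain h where ih: "i = Suc h" using c by (cases i) auto
      have K: "h \<in> K" "Suc q \<in> K" using c ik assms(7)[of k] assms(7)[of i] kq ih by auto
      have "d (Suc m) (Suc h) \<cdot> (s m t \<cdot> l (Suc q)) = s p t \<cdot> (d m h \<cdot> l (Suc q))"
        using c ik k kq ih m K by (intro hi l) auto
      also have "\<dots> = s p t \<cdot> (d m q \<cdot> l h)" using ll[of h "Suc q"] K ik ih kq by simp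
      also have "\<dots> = d (Suc m) (Suc q) \<cdot> (s m t \<cdot> l h)"
        using c ik k kq ih m K by (intro hi[symmetric] l) auto
      finally show ?thesis using c ik kq ih by simp
    qed
  qed
qed

end

section \<open>From (E5) to the Kan condition\<close>

context extensions
begin

text \<open>Two universal objects are linked by a canonical isomorphism \<open>u\<close>, which is
  in \<open>E\<close> by (E1), and \<open>e = u \<cdot> c\<close> is in \<open>E\<close> by (E3).
  This passes from one horn object to all the choices quantified over in \<open>Kan\<close>.\<close>

lemma partial_horn_comparison_unique:
  assumes "semi_simplicial C A d" "I \<subset> {..n}"
    and H: "is_partial_horn C A d n I H a" and K: "is_partial_horn C A d n I K k"
    and c: "c \<in> E" "c \<in> hom C X H" and e: "e \<in> hom C X K"
    and ce: "\<And>i. i \<in> I \<Longrightarrow> a i \<cdot> c = k i \<cdot> e"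
  shows "e \<in> E"
proof -
  interpret semi_simplicial_object C A d
    using assms(1) by unfold_locales
  have Hcone: "face_cone C A d n I H a" and Kcone: "face_cone C A d n I K k"
    using H K by (simp_all add: is_partial_horn_def)
  obtain u where u: "u \<in> hom C H K" "\<And>i. i \<in> I \<Longrightarrow> k i \<cdot> u = a i"
    using is_partial_horn_lift[OF K Hcone] by blast
  obtain v where v: "v \<in> hom C K H" "\<And>i. i \<in> I \<Longrightarrow> a i \<cdot> v = k i"
    using is_partial_horn_lift[OF H Kcone] by blast
  note a = is_partial_horn_proj[OF H] and k = is_partial_horn_proj[OF K]
  have vu: "v \<cdot> u = Ident C H"
  proof (rule is_partial_horn_eqI[OF H _ _ assms(2)])
    show "a i \<cdot> (v \<cdot> u) = a i \<cdot> Ident C H" if "i \<in> I" for i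
      using hom_assoc[OF u(1) v(1) a(2)[OF that]] Ident_right[OF a(2)[OF that]] u v that by simp
  qed (use u v a Comp_hom Ident_hom in blast)+
  have uv: "u \<cdot> v = Ident C K"
  proof (rule is_partial_horn_eqI[OF K _ _ assms(2)])
    show "k i \<cdot> (u \<cdot> v) = k i \<cdot> Ident C K" if "i \<in> I" for i
      using hom_assoc[OF v(1) u(1) k(2)[OF that]] Ident_right[OF k(2)[OF that]] u v that by simp
  qed (use u v k Comp_hom Ident_hom in blast)+
  have "isomorphism C u"
    using u(1) v(1) vu uv by (auto simp: isomorphism_def hom_def)
  then have "u \<in> E" using E1 by (simp add: E1_def)
  then have "u \<cdot> c \<in> E" using comp_in_E c u(1) by (simp add: hom_def)
  moreover have "u \<cdot> c = e"
  proof (rule is_partial_horn_eqI[OF K _ e assms(2)])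
    show "u \<cdot> c \<in> hom C X K" using c u Comp_hom by blast
    show "k i \<cdot> (u \<cdot> c) = k i \<cdot> e" if "i \<in> I" for i
      using hom_assoc[OF c(2) u(1) k(2)[OF that]] u ce that by simp
  qed
  ultimately show ?thesis by simp
qed

end

locale quasi_simplicial_in_extensions =
  extensions C E + quasi_simplicial_object C A d s
  for C :: "('o, 'm, 'z) cat_scheme" (structure) and E A d s
begin

definition horn_in_E :: "nat \<Rightarrow> nat set \<Rightarrow> bool" where
  "horn_in_E n I \<longleftrightarrow> (\<exists>H a c. is_partial_horn C A d n I H a \<and> c \<in> hom C (A n) H \<and> c \<in> E \<and>
     (\<forall>i\<in>I. a i \<cdot> c = d n i))"

text \<open>Face \<open>0\<close> is split by \<open>s n 0\<close> and face \<open>Suc j\<close> by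
  \<open>s n j\<close>.\<close>

lemma face_in_E:
  assumes "i \<le> Suc n"
  shows "d (Suc n) i \<in> E"
proof (cases i)
  case 0
  then show ?thesis
    using split_epi_in_E[OF face_hom degen_hom face_degen(2)[of 0 n i]] by simp
next
  case (Suc j)
  then show ?thesis
    using split_epi_in_E[OF face_hom degen_hom face_degen(2)[of j n i]] assms by simp
qed

text \<open>A single face carries no matching condition, so \<open>A n\<close> with the identity is
  universal and the comparison is the face itself.\<close>

lemma horn_in_E_singleton:
  assumes "j \<le> Suc n"
  shows "horn_in_E (Suc n) {j}"
proof -
  have "is_partial_horn C A d (Suc n) {j} (A n) (\<lambda>_. Ident C (A n))"
    using obj Ident_hom by (auto simp: is_partial_horn_def face_cone_def Ident_left)
  then show ?thesis
    using face_in_E[OF assms] face_hom[OF assms] Ident_left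
    unfolding horn_in_E_def by (intro exI conjI) auto
qed

text \<open>A family on \<open>I\<close> is a family on \<open>I - {j}\<close>, classified by
  \<open>H\<close>, together with a \<open>j\<close>-th component whose faces are those the family
  prescribes. Families of such faces are classified by \<open>H'\<close>, so the object sought is a
  pullback over \<open>H'\<close>; (E5) supplies it and puts the comparison into
  \<open>E\<close>.\<close>

lemma horn_in_E_step:
  assumes E5: "E5 C E" and I: "I \<subseteq> {..Suc (Suc m)}" and t: "t \<le> Suc m" "I \<inter> {t, Suc t} = {j}"
    and H: "horn_in_E (Suc (Suc m)) (I - {j})" and H': "horn_in_E (Suc m) (coface j -` I)"
  shows "horn_in_E (Suc (Suc m)) I"
proof -
  let ?n = "Suc (Suc m)" and ?I' = "coface j -` I"
  have jI: "j \<in> I" and jt: "j = t \<or> j = Suc t" and j: "j \<le> ?n"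
    using t I by auto
  have split: "i < t \<or> Suc t < i" if "i \<in> I - {j}" for i
  proof -
    have "i \<noteq> t" "i \<noteq> Suc t" using that t(2) by blast+
    then show ?thesis by linarith
  qed
  have coface_I: "coface j i \<in> I - {j}" if "i \<in> ?I'" for i
    using that by (simp add: coface_neq)
  \<comment> \<open>\<open>coface j t\<close> is the member of \<open>{t, Suc t}\<close> other than
    \<open>j\<close>, hence outside \<open>I\<close>. This makes \<open>?I'\<close> a proper
    subset.\<close>
  have "t \<notin> ?I'"
  proof -
    have "coface j t \<in> {t, Suc t}" by (simp add: coface_def)
    then show ?thesis using t(2) coface_neq[of j t] by blast
  qed
  moreover have I'_bound: "i \<le> Suc m" if "i \<in> ?I'" for i
  proof -
    have "coface j i \<le> ?n" using that I by auto
    then show ?thesis using j by (auto simp: coface_def split: if_splits)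
  qed
  ultimately have I': "?I' \<subset> {..Suc m}" using t(1) by auto
  have IJ: "I - {j} \<subset> {..?n}" using I j by auto
  obtain H a c where H: "is_partial_horn C A d ?n (I - {j}) H a"
    and c: "c \<in> hom C (A ?n) H" "c \<in> E" "\<And>i. i \<in> I - {j} \<Longrightarrow> a i \<cdot> c = d ?n i"
    using H unfolding horn_in_E_def by blast
  obtain H' b c' where H': "is_partial_horn C A d (Suc m) ?I' H' b"
    and c': "c' \<in> hom C (A (Suc m)) H'" "c' \<in> E" "\<And>i. i \<in> ?I' \<Longrightarrow> b i \<cdot> c' = d (Suc m) i"
    using H' unfolding horn_in_E_def by blast
  have acone: "face_cone C A d ?n (I - {j}) H a" and bcone: "face_cone C A d (Suc m) ?I' H' b"
    using H H' by (simp_all add: is_partial_horn_def)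
  have a: "a i \<in> hom C H (A (Suc m))" if "i \<in> I - {j}" for i
    using is_partial_horn_proj(2)[OF H that] by simp
  have b: "b i \<in> hom C H' (A m)" if "i \<in> ?I'" for i
    using is_partial_horn_proj(2)[OF H' that] by simp
  have dual: "d (Suc m) (coface_dual j i) \<in> hom C (A (Suc m)) (A m)" if "i \<in> ?I'" for i
    using I'_bound[OF that] j by (intro face_hom) (auto simp: coface_dual_def)

  \<comment> \<open>\<open>f0\<close> sends a family to the faces it prescribes for the missing
    \<open>j\<close>-th component.\<close>
  have "face_cone C A d (Suc m) ?I' H (\<lambda>i. d (Suc m) (coface_dual j i) \<cdot> a (coface j i))"
    using coface_I I by (intro face_cone_face[OF acone I' _ _ j]) auto
  from is_partial_horn_lift[OF H' this]
  obtain f0 where f0: "f0 \<in> hom C H H'"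
    "\<And>i. i \<in> ?I' \<Longrightarrow> b i \<cdot> f0 = d (Suc m) (coface_dual j i) \<cdot> a (coface j i)"
    by blast
  \<comment> \<open>\<open>s0\<close> is induced by the \<open>t\<close>-th degeneracy:
    \<open>I - {j}\<close> avoids \<open>t\<close> and \<open>Suc t\<close>, and the faces needed to
    express the result have indices in \<open>?I'\<close>.\<close>
  have lower: "i \<in> ?I'" if "i \<in> I - {j}" "i < t" for i
    using that jt by (auto simp: coface_def)
  have upper: "i - 1 \<in> ?I'" if "i \<in> I - {j}" "Suc t < i" for i
    using that jt by (auto simp: coface_def)
  have "t \<notin> I - {j}" "Suc t \<notin> I - {j}" using t(2) by auto
  then have "face_cone C A d ?n (I - {j}) H' (\<lambda>i. if i < t then s m (t - 1) \<cdot> b i else s m t \<cdot> b (i - 1))"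
    using I lower upper by (intro face_cone_degen[OF bcone _ _ _ t(1)]) auto
  from is_partial_horn_lift[OF H this]
  obtain s0 where s0: "s0 \<in> hom C H' H"
    "\<And>i. i \<in> I - {j} \<Longrightarrow> a i \<cdot> s0 = (if i < t then s m (t - 1) \<cdot> b i else s m t \<cdot> b (i - 1))"
    by blast
  have dj: "d ?n j \<in> hom C (A ?n) (A (Suc m))" using j by (rule face_hom)
  have st: "s (Suc m) t \<in> hom C (A (Suc m)) (A ?n)" using t(1) by (rule degen_hom)
  have dj_st: "d ?n j \<cdot> s (Suc m) t = Ident C (A (Suc m))"
    using face_degen(2)[OF t(1)] jt by simp

  have f0_c: "f0 \<cdot> c = c' \<cdot> d ?n j"
  proof (rule is_partial_horn_eqI[OF H' _ _ I'])
    show "f0 \<cdot> c \<in> hom C (A ?n) H'" "c' \<cdot> d ?n j \<in> hom C (A ?n) H'"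
      using f0 c c' dj Comp_hom by blast+
    fix i assume i: "i \<in> ?I'"
    have "b i \<cdot> (f0 \<cdot> c) = d (Suc m) (coface_dual j i) \<cdot> (a (coface j i) \<cdot> c)"
      using square_precomp[OF f0(2)[OF i] f0(1) b[OF i] a[OF coface_I[OF i]] dual[OF i] c(1)] .
    also have "\<dots> = d (Suc m) (coface_dual j i) \<cdot> d ?n (coface j i)"
      using c(3) coface_I[OF i] by simp
    also have "\<dots> = d (Suc m) i \<cdot> d ?n j"
      using face_cone_coface[OF face_cone_subset[OF face_cone_faces[of ?n "Suc m"] I] i jI] by simp
    also have "\<dots> = b i \<cdot> (c' \<cdot> d ?n j)"
      using hom_assoc[OF dj c'(1) b[OF i]] c'(3)[OF i] by simp
    finally show "b i \<cdot> (f0 \<cdot> c) = b i \<cdot> (c' \<cdot> d ?n j)" .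
  qed
  have c_st: "c \<cdot> s (Suc m) t = s0 \<cdot> c'"
  proof (rule is_partial_horn_eqI[OF H _ _ IJ])
    show "c \<cdot> s (Suc m) t \<in> hom C (A (Suc m)) H" "s0 \<cdot> c' \<in> hom C (A (Suc m)) H"
      using c st s0 c' Comp_hom by blast+
    fix i assume i: "i \<in> I - {j}"
    have l: "a i \<cdot> (c \<cdot> s (Suc m) t) = d ?n i \<cdot> s (Suc m) t"
      using hom_assoc[OF st c(1) a[OF i]] c(3)[OF i] by simp
    have r: "a i \<cdot> (s0 \<cdot> c') = (if i < t then s m (t - 1) \<cdot> b i else s m t \<cdot> b (i - 1)) \<cdot> c'"
      using hom_assoc[OF c'(1) s0(1) a[OF i]] s0(2)[OF i] by simp
    show "a i \<cdot> (c \<cdot> s (Suc m) t) = a i \<cdot> (s0 \<cdot> c')"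
    proof (cases "i < t")
      case True
      have "s m (t - 1) \<in> hom C (A m) (A (Suc m))" using t(1) by (intro degen_hom) auto
      then have "(s m (t - 1) \<cdot> b i) \<cdot> c' = s m (t - 1) \<cdot> d (Suc m) i"
        using hom_assoc[OF c'(1) b[OF lower[OF i True]]] c'(3)[OF lower[OF i True]] by simp
      then show ?thesis using l r True face_degen(1)[OF t(1) True] by simp
    next
      case False
      then have g: "Suc t < i" using split[OF i] by simp
      have "i \<le> ?n" using i I by auto
      then have "s m t \<in> hom C (A m) (A (Suc m))" using g by (intro degen_hom) auto
      then have "(s m t \<cdot> b (i - 1)) \<cdot> c' = s m t \<cdot> d (Suc m) (i - 1)"
        using hom_assoc[OF c'(1) b[OF upper[OF i g]]] c'(3)[OF upper[OF i g]] by simp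
      then show ?thesis using l r False face_degen(3)[OF t(1) g] \<open>i \<le> ?n\<close> by simp
    qed
  qed
  \<comment> \<open>A face cancels a degeneracy in each component: for \<open>i < j\<close> it is
    face \<open>j - 1\<close> after \<open>s m (t - 1)\<close>, otherwise face \<open>j\<close>
    after \<open>s m t\<close>, and \<open>j\<close> is \<open>t\<close> or
    \<open>Suc t\<close>.\<close>
  have f0_s0: "f0 \<cdot> s0 = Ident C H'"
  proof (rule is_partial_horn_eqI[OF H' _ _ I'])
    show "f0 \<cdot> s0 \<in> hom C H' H'" "Ident C H' \<in> hom C H' H'"
      using f0 s0 Comp_hom Ident_hom is_partial_horn_proj(1)[OF H'] by blast+
    fix i assume i: "i \<in> ?I'"
    have ci: "coface j i \<in> I - {j}" using i by (rule coface_I)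
    have "b i \<cdot> (f0 \<cdot> s0) = d (Suc m) (coface_dual j i) \<cdot> (a (coface j i) \<cdot> s0)"
      using square_precomp[OF f0(2)[OF i] f0(1) b[OF i] a[OF ci] dual[OF i] s0(1)] .
    also have "\<dots> = b i"
    proof (cases "i < j")
      case True
      then have it: "i < t" using split[OF ci] jt by (auto simp: coface_def)
      have "d (Suc m) (j - 1) \<cdot> (s m (t - 1) \<cdot> b i) = b i"
        using it jt t(1) by (intro face_degen_elem_eq[OF b[OF i]]) auto
      then show ?thesis using s0(2)[OF ci] it True by (simp add: coface_def coface_dual_def)
    next
      case False
      then have it: "t < i" using split[OF ci] jt by (auto simp: coface_def)
      have "d (Suc m) j \<cdot> (s m t \<cdot> b i) = b i"
        using it jt t(1) I'_bound[OF i] by (intro face_degen_elem_eq[OF b[OF i]]) auto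
      then show ?thesis using s0(2)[OF ci] it False by (simp add: coface_def coface_dual_def)
    qed
    finally show "b i \<cdot> (f0 \<cdot> s0) = b i \<cdot> Ident C H'"
      using b[OF i] by (simp add: Ident_right)
  qed

  \<comment> \<open>The comparisons \<open>c\<close> and \<open>c'\<close>, in \<open>E\<close> by
    assumption, are the extensions; \<open>d ?n j\<close> and \<open>f0\<close> are split by
    \<open>s (Suc m) t\<close> and \<open>s0\<close>.\<close>
  have "split_epi_of_extensions C E c c' (d ?n j) f0 (s (Suc m) t) s0"
    using c c' f0 s0 dj st f0_c c_st f0_s0 dj_st
    by (simp add: split_epi_of_extensions_def commutative_square_def hom_def)
  then have dbl: "double_extension C E c c' (d ?n j) f0"
    using E5 unfolding E5_def by blast
  then obtain P p q where P: "is_pullback C f0 c' P p q"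
    unfolding double_extension_def by blast
  have p: "p \<in> hom C P H" and q: "q \<in> hom C P (A (Suc m))" and pq: "f0 \<cdot> p = c' \<cdot> q"
    using is_pullback_square[OF P] f0(1) c'(1) by (auto simp: hom_def)
  obtain e where e: "e \<in> hom C (A ?n) P" "p \<cdot> e = c" "q \<cdot> e = d ?n j"
    using is_pullback_lift[OF P, of c "A ?n" "d ?n j"] c dj f0 c' f0_c by (auto simp: hom_def)
  have "e \<in> E"
    using dbl P e c(1) unfolding double_extension_def by (simp add: hom_def)

  \<comment> \<open>The pullback \<open>P\<close> as a partial horn: component \<open>j\<close> is
    the projection \<open>q\<close>, the others come from \<open>H\<close> along
    \<open>p\<close>.\<close>
  define k where "k i = (if i = j then q else a i \<cdot> p)" for i
  have k: "k i \<in> hom C P (A (Suc m))" if "i \<in> I" for i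
    using that q p a Comp_hom by (auto simp: k_def)
  \<comment> \<open>Read through the projections \<open>b i\<close>, the pullback equation
    \<open>f0 \<cdot> p = c' \<cdot> q\<close> is the matching condition between \<open>j\<close>
    and the other indices.\<close>
  have kpq: "d (Suc m) i \<cdot> q = d (Suc m) (coface_dual j i) \<cdot> k (coface j i)" if i: "i \<in> ?I'" for i
  proof -
    have "d (Suc m) i \<cdot> q = b i \<cdot> (f0 \<cdot> p)"
      using hom_assoc[OF q c'(1) b[OF i]] c'(3)[OF i] pq by simp
    also have "\<dots> = d (Suc m) (coface_dual j i) \<cdot> (a (coface j i) \<cdot> p)"
      using square_precomp[OF f0(2)[OF i] f0(1) b[OF i] a[OF coface_I[OF i]] dual[OF i] p] .
    finally show ?thesis by (simp add: k_def coface_neq)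
  qed
  have ap: "face_cone C A d ?n (I - {j}) P (\<lambda>i. a i \<cdot> p)"
    using face_cone_precomp[OF acone p] IJ by auto
  have "is_partial_horn C A d ?n I P k"
    unfolding is_partial_horn_def
  proof (intro conjI allI impI)
    show "face_cone C A d ?n I P k"
      unfolding face_cone_def
    proof (intro conjI ballI impI)
      show "P \<in> Obj C" using hom_Obj p by blast
      show "k i \<in> hom C P (A (?n - 1))" if "i \<in> I" for i using k that by simp
      fix i l assume il: "i \<in> I" "l \<in> I" "i < l"
      consider "l = j" | "i = j" | "i \<noteq> j" "l \<noteq> j" by blast
      then show "d (?n - 1) i \<cdot> k l = d (?n - 1) (l - 1) \<cdot> k i"
      proof cases
        case 1
        then show ?thesis using kpq[of i] il by (simp add: k_def coface_def coface_dual_def)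
      next
        case 2
        then have "coface j (l - 1) = l" "\<not> l - 1 < j" using il by (auto simp: coface_def)
        then show ?thesis using kpq[of "l - 1"] 2 il by (simp add: k_def coface_dual_def)
      next
        case 3
        then show ?thesis using ap il by (simp add: face_cone_def k_def)
      qed
    qed
    fix L l assume lcone: "face_cone C A d ?n I L l"
    have l: "l i \<in> hom C L (A (Suc m))" if "i \<in> I" for i
      using lcone that by (simp add: face_cone_def)
    obtain u where u: "u \<in> hom C L H" "\<And>i. i \<in> I - {j} \<Longrightarrow> a i \<cdot> u = l i"
      using is_partial_horn_lift[OF H face_cone_subset[OF lcone]] by blast
    \<comment> \<open>Conversely, the matching conditions of \<open>l\<close> at \<open>j\<close>
      say that \<open>u\<close> and \<open>l j\<close> agree in \<open>H'\<close>, so they induce a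
      morphism into \<open>P\<close>.\<close>
    have "f0 \<cdot> u = c' \<cdot> l j"
    proof (rule is_partial_horn_eqI[OF H' _ _ I'])
      show "f0 \<cdot> u \<in> hom C L H'" "c' \<cdot> l j \<in> hom C L H'"
        using f0 u c' l[OF jI] Comp_hom by blast+
      fix i assume i: "i \<in> ?I'"
      have "b i \<cdot> (f0 \<cdot> u) = d (Suc m) (coface_dual j i) \<cdot> (a (coface j i) \<cdot> u)"
        using square_precomp[OF f0(2)[OF i] f0(1) b[OF i] a[OF coface_I[OF i]] dual[OF i] u(1)] .
      also have "\<dots> = d (Suc m) i \<cdot> l j"
        using face_cone_coface[OF lcone i jI] u(2)[OF coface_I[OF i]] by simp
      also have "\<dots> = b i \<cdot> (c' \<cdot> l j)"
        using hom_assoc[OF l[OF jI] c'(1) b[OF i]] c'(3)[OF i] by simp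
      finally show "b i \<cdot> (f0 \<cdot> u) = b i \<cdot> (c' \<cdot> l j)" .
    qed
    then obtain w where w: "w \<in> hom C L P" "p \<cdot> w = u" "q \<cdot> w = l j"
      using is_pullback_lift[OF P, of u L "l j"] u(1) l[OF jI] f0(1) c'(1) by (auto simp: hom_def)
    show "\<exists>!v. v \<in> hom C L P \<and> (\<forall>i\<in>I. k i \<cdot> v = l i)"
    proof (rule ex1I)
      have "k i \<cdot> w = l i" if "i \<in> I" for i
        using that w u hom_assoc[OF w(1) p a, of i] by (auto simp: k_def)
      then show "w \<in> hom C L P \<and> (\<forall>i\<in>I. k i \<cdot> w = l i)" using w(1) by blast
      fix v assume v: "v \<in> hom C L P \<and> (\<forall>i\<in>I. k i \<cdot> v = l i)"
      show "v = w"
      proof (rule is_pullback_eqI[OF P _ w(1)])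
        show "v \<in> hom C L P" using v by blast
        show "q \<cdot> v = q \<cdot> w" using v jI w(3) by (auto simp: k_def)
        have pv: "p \<cdot> v \<in> hom C L H" using v p Comp_hom by blast
        have "p \<cdot> v = u"
        proof (rule is_partial_horn_eqI[OF H pv u(1) IJ])
          fix i assume i: "i \<in> I - {j}"
          have "k i \<cdot> v = l i" using v i by blast
          then show "a i \<cdot> (p \<cdot> v) = a i \<cdot> u"
            using i u(2)[OF i] v hom_assoc[OF _ p a[OF i], of v L] by (simp add: k_def)
        qed
        then show "p \<cdot> v = p \<cdot> w" using w(2) by simp
      qed
    qed
  qed
  moreover have "k i \<cdot> e = d ?n i" if "i \<in> I" for i
    using that e hom_assoc[OF e(1) p a, of i] c(3) by (auto simp: k_def)
  ultimately show ?thesis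
    using e(1) \<open>e \<in> E\<close> unfolding horn_in_E_def by blast
qed

text \<open>The dimension varies in the induction, since the step uses one smaller index set in the
  same dimension and one in the dimension below.\<close>

lemma horn_in_E:
  assumes E5: "E5 C E" and "I \<subset> {..Suc n}" "I \<noteq> {}"
  shows "horn_in_E (Suc n) I"
  using assms(2,3)
proof (induction "card I" arbitrary: n I rule: less_induct)
  case less
  have fin: "finite I" using less.prems(1) finite_subset by blast
  obtain t j where tj: "t < Suc n" "I \<inter> {t, Suc t} = {j}"
    using boundary_index[of I "Suc n"] less.prems by blast
  have jI: "j \<in> I" using tj(2) by blast
  show ?case
  proof (cases "I = {j}")
    case True
    then show ?thesis using horn_in_E_singleton[of j n] less.prems(1) by auto
  next
    case False
    then obtain i where i: "i \<in> I" "i \<noteq> j" using jI by blast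
    \<comment> \<open>In dimension 1 the pair \<open>t\<close>, \<open>Suc t\<close> exhausts the
      indices, which would force \<open>I = {j}\<close>.\<close>
    have "n \<noteq> 0"
    proof
      assume "n = 0"
      then have "{..Suc n} \<subseteq> {t, Suc t}" using tj(1) by auto
      then have "I = {j}" using less.prems(1) tj(2) by blast
      then show False using False by blast
    qed
    then obtain m where n: "n = Suc m" by (cases n) auto
    \<comment> \<open>As \<open>coface j\<close> is injective and misses \<open>j\<close>, the index
      set one dimension down is no larger than \<open>I - {j}\<close>. The second element
      \<open>i\<close> of \<open>I\<close> keeps both sets nonempty.\<close>
    have sub: "coface j ` (coface j -` I) \<subseteq> I - {j}" by (auto simp: coface_neq)
    have "card (coface j -` I) \<le> card (I - {j})"
      using fin sub by (intro card_inj_on_le[of "coface j"]) (auto intro: inj_on_subset[OF inj_coface])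
    then have card: "card (coface j -` I) < card I"
      using card_Diff1_less[OF fin jI] by linarith
    have "j \<le> Suc n" using jI less.prems(1) by auto
    have bound: "coface j -` I \<subseteq> {..n}"
    proof
      fix x assume "x \<in> coface j -` I"
      then have "coface j x \<le> Suc n" using less.prems(1) by auto
      then show "x \<in> {..n}" using \<open>j \<le> Suc n\<close> by (auto simp: coface_def split: if_splits)
    qed
    have "coface j t \<in> {t, Suc t}" by (simp add: coface_def)
    then have "t \<notin> coface j -` I" using tj(2) coface_neq[of j t] by blast
    then have "coface j -` I \<subset> {..n}" using bound tj(1) by auto
    moreover have "coface j -` I \<noteq> {}"
    proof -
      have "coface j (if i < j then i else i - 1) = i" using i(2) by (auto simp: coface_def)
      then show ?thesis using i(1) by (metis empty_iff vimageI2)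
    qed
    ultimately have "horn_in_E n (coface j -` I)"
      using less.hyps[OF card, of m] n by simp
    moreover have "horn_in_E (Suc n) (I - {j})"
      using less.hyps[of "I - {j}" n] card_Diff1_less[OF fin jI] less.prems(1) i by blast
    ultimately show ?thesis
      using horn_in_E_step[OF E5, of I m t j] less.prems(1) tj n by auto
  qed
qed

lemma Kan_if_E5:
  assumes "E5 C E"
  shows "Kan C E A d"
  unfolding Kan_def is_horn_object_iff_partial
proof (intro conjI allI impI)
  show "d 1 0 \<in> E" "d 1 1 \<in> E" using face_in_E[of _ 0] by simp_all
  fix n k :: nat assume nk: "2 \<le> n \<and> k \<le> n"
  let ?I = "{..n} - {k}"
  have I: "?I \<subset> {..n}" using nk by auto
  moreover have "?I \<noteq> {}"
  proof -
    have "(if k = 0 then 1 else 0) \<in> ?I" using nk by auto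
    then show ?thesis by blast
  qed
  ultimately have "horn_in_E n ?I" using horn_in_E[OF assms, of ?I "n - 1"] nk by simp
  then obtain H a c where H: "is_partial_horn C A d n ?I H a" "c \<in> hom C (A n) H" "c \<in> E"
    "\<forall>i\<in>?I. a i \<cdot> c = d n i"
    unfolding horn_in_E_def by blast
  then show "\<exists>H a. is_partial_horn C A d n ?I H a" by blast
  fix K b e
  assume K: "is_partial_horn C A d n ?I K b \<and> e \<in> hom C (A n) K \<and>
    (\<forall>i. i \<le> n \<and> i \<noteq> k \<longrightarrow> b i \<cdot> e = d n i)"
  show "e \<in> E"
    by (rule partial_horn_comparison_unique[OF semi I H(1) _ H(3,2)]) (use K H(4) in auto)
qed

end

section \<open>The coskeleton of a reflexive graph\<close>

text \<open>Levels 0 and 1 form a graph with common section \<open>r\<close>; each further level is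
  the simplicial kernel of all faces one level below. The argument \<open>Suc n\<close> of the
  kernel is the largest index of a face out of \<open>A (Suc n)\<close>, so the projections are
  indexed up to \<open>Suc (Suc n)\<close>.\<close>

locale coskeletal_object = category C for C :: "('o, 'm, 'z) cat_scheme" (structure) +
  fixes A :: "nat \<Rightarrow> 'o" and d :: "nat \<Rightarrow> nat \<Rightarrow> 'm" and r :: 'm
  assumes edge: "i \<le> Suc 0 \<Longrightarrow> d (Suc 0) i \<in> hom C (A (Suc 0)) (A 0)"
    and kernel: "is_simplicial_kernel C (Suc n) (A (Suc n)) (d (Suc n)) (A (Suc (Suc n))) (d (Suc (Suc n)))"
    and loop: "r \<in> hom C (A 0) (A (Suc 0))" "i \<le> Suc 0 \<Longrightarrow> d (Suc 0) i \<cdot> r = Ident C (A 0)"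
begin

lemma kernel_cone:
  "simplicial_cone C (Suc n) (A (Suc n)) (d (Suc n)) (A (Suc (Suc n))) (d (Suc (Suc n)))"
  using kernel by (simp add: is_simplicial_kernel_def)

sublocale semi_simplicial_object C A d
proof unfold_locales
  have obj: "A n \<in> Obj C" for n
  proof (cases n)
    case 0
    then show ?thesis using hom_Obj(1)[OF loop(1)] by simp
  next
    case (Suc m)
    show ?thesis
    proof (cases m)
      case 0
      then show ?thesis using hom_Obj(2)[OF loop(1)] Suc by simp
    next
      case (Suc p)
      then show ?thesis using kernel_cone[of p] \<open>n = Suc m\<close> by (simp add: simplicial_cone_def)
    qed
  qed
  moreover have "d n i \<in> hom C (A n) (A (n - 1))" if ni: "1 \<le> n" "i \<le> n" for n i
  proof (cases "n = 1")
    case True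
    then show ?thesis using edge[of i] ni by simp
  next
    case False
    then have "n = Suc (Suc (n - 2))" using ni(1) by linarith
    then obtain m where "n = Suc (Suc m)" by blast
    then show ?thesis using kernel_cone[of m] ni(2) by (simp add: simplicial_cone_def)
  qed
  moreover have "d (n - 1) i \<cdot> d n j = d (n - 1) (j - 1) \<cdot> d n i" if nij: "2 \<le> n" "i < j" "j \<le> n" for n i j
  proof -
    have "n = Suc (Suc (n - 2))" using nij(1) by linarith
    then obtain m where "n = Suc (Suc m)" by blast
    then show ?thesis using kernel_cone[of m] nij(2,3) by (simp add: simplicial_cone_def)
  qed
  ultimately show "semi_simplicial C A d" unfolding semi_simplicial_def by blast
qed

lemma kernel_lift:
  assumes "\<And>i. i \<le> Suc (Suc n) \<Longrightarrow> x i \<in> hom C L (A (Suc n))"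
    and "\<And>i k. i < k \<Longrightarrow> k \<le> Suc (Suc n) \<Longrightarrow> d (Suc n) i \<cdot> x k = d (Suc n) (k - 1) \<cdot> x i"
  obtains u where "u \<in> hom C L (A (Suc (Suc n)))" "\<And>i. i \<le> Suc (Suc n) \<Longrightarrow> d (Suc (Suc n)) i \<cdot> u = x i"
proof -
  have "simplicial_cone C (Suc n) (A (Suc n)) (d (Suc n)) L x"
    using assms hom_Obj(1)[OF assms(1)[of 0]] by (simp add: simplicial_cone_def)
  then have "\<exists>u. u \<in> hom C L (A (Suc (Suc n))) \<and>
      (\<forall>i \<le> Suc n + 1. d (Suc (Suc n)) i \<cdot> u = x i)"
    using kernel[of n] unfolding is_simplicial_kernel_def by blast
  then show thesis using that by auto
qed

lemma kernel_eqI: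
  assumes u: "u \<in> hom C L (A (Suc (Suc n)))" and v: "v \<in> hom C L (A (Suc (Suc n)))"
    and eq: "\<And>i. i \<le> Suc (Suc n) \<Longrightarrow> d (Suc (Suc n)) i \<cdot> u = d (Suc (Suc n)) i \<cdot> v"
  shows "u = v"
proof -
  have "simplicial_cone C (Suc n) (A (Suc n)) (d (Suc n)) L (\<lambda>i. d (Suc (Suc n)) i \<cdot> u)"
    using hom_Obj(1)[OF u] face_comp[OF u] face_face_elem[OF u] by (simp add: simplicial_cone_def)
  then have "\<exists>!w. w \<in> hom C L (A (Suc (Suc n))) \<and>
      (\<forall>i \<le> Suc n + 1. d (Suc (Suc n)) i \<cdot> w = d (Suc (Suc n)) i \<cdot> u)"
    using kernel[of n] unfolding is_simplicial_kernel_def by blast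
  moreover have "\<forall>i \<le> Suc n + 1. d (Suc (Suc n)) i \<cdot> v = d (Suc (Suc n)) i \<cdot> u"
    using eq by simp
  ultimately show ?thesis using u v by blast
qed

text \<open>The value that the simplicial identities prescribe for face \<open>i\<close> of the
  \<open>j\<close>-th degeneracy, \<open>\<tau>\<close> being the degeneracies one dimension
  lower.\<close>

definition degen_face :: "nat \<Rightarrow> (nat \<Rightarrow> 'm) \<Rightarrow> nat \<Rightarrow> nat \<Rightarrow> 'm" where
  "degen_face n \<tau> j i =
    (if i < j then \<tau> (j - 1) \<cdot> d n i else if i \<le> Suc j then Ident C (A n) else \<tau> j \<cdot> d n (i - 1))"

text \<open>\<open>\<sigma>\<close> are degeneracies out of \<open>A n\<close> and
  \<open>\<tau>\<close> those out of \<open>A (n - 1)\<close>; the guard \<open>n \<noteq> 0\<close>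
  is for the bottom dimension, which has nothing below it.\<close>

definition degens :: "nat \<Rightarrow> (nat \<Rightarrow> 'm) \<Rightarrow> (nat \<Rightarrow> 'm) \<Rightarrow> bool" where
  "degens n \<tau> \<sigma> \<longleftrightarrow>
    (n \<noteq> 0 \<longrightarrow> (\<forall>j<n. \<tau> j \<in> hom C (A (n - 1)) (A n))) \<and>
    (\<forall>j\<le>n. \<sigma> j \<in> hom C (A n) (A (Suc n)) \<and> (\<forall>i\<le>Suc n. d (Suc n) i \<cdot> \<sigma> j = degen_face n \<tau> j i))"

lemma degens_0: "degens 0 \<tau> (\<lambda>_. r)"
  using loop by (auto simp: degens_def degen_face_def)

text \<open>The faces prescribed for a new degeneracy form a simplicial cone, so the simplicial
  kernel supplies the degeneracy.\<close>

lemma degens_Suc: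
  assumes \<sigma>: "degens n \<tau> \<sigma>"
  obtains \<rho> where "degens (Suc n) \<sigma> \<rho>"
proof -
  have \<sigma>_hom: "\<sigma> j \<in> hom C (A n) (A (Suc n))" if "j \<le> n" for j
    using \<sigma> that by (simp add: degens_def)
  have id: "d (Suc n) i \<cdot> (\<sigma> j \<cdot> x) = x"
    if "x \<in> hom C L (A n)" "j \<le> n" "i = j \<or> i = Suc j" for L x i j
    using that \<sigma> by (intro retract_precomp[OF _ \<sigma>_hom face_hom]) (auto simp: degens_def degen_face_def)
  have lo: "d (Suc n) i \<cdot> (\<sigma> j \<cdot> x) = \<tau> (j - 1) \<cdot> (d n i \<cdot> x)"
    if "x \<in> hom C L (A n)" "j \<le> n" "i < j" for L x i j
  proof (rule square_precomp)
    show "d (Suc n) i \<cdot> \<sigma> j = \<tau> (j - 1) \<cdot> d n i"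
      using that \<sigma> by (simp add: degens_def degen_face_def)
    show "d n i \<in> hom C (A n) (A (n - 1))" using that face_hom[of i "n - 1"] by simp
    show "\<tau> (j - 1) \<in> hom C (A (n - 1)) (A (Suc n - 1))" using that \<sigma> by (simp add: degens_def)
    show "d (Suc n) i \<in> hom C (A (Suc n)) (A (Suc n - 1))" using that face_hom[of i n] by simp
  qed (use that \<sigma>_hom in auto)
  have hi: "d (Suc n) i \<cdot> (\<sigma> j \<cdot> x) = \<tau> j \<cdot> (d n (i - 1) \<cdot> x)"
    if "x \<in> hom C L (A n)" "Suc j < i" "i \<le> Suc n" for L x i j
  proof (rule square_precomp)
    show "d (Suc n) i \<cdot> \<sigma> j = \<tau> j \<cdot> d n (i - 1)"
      using that \<sigma> by (simp add: degens_def degen_face_def)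
    show "d n (i - 1) \<in> hom C (A n) (A (n - 1))" using that face_hom[of "i - 1" "n - 1"] by simp
    show "\<tau> j \<in> hom C (A (n - 1)) (A (Suc n - 1))" using that \<sigma> by (simp add: degens_def)
    show "d (Suc n) i \<in> hom C (A (Suc n)) (A (Suc n - 1))" using that face_hom[of i n] by simp
    show "\<sigma> j \<in> hom C (A n) (A (Suc n))" using that \<sigma>_hom by simp
  qed (use that in auto)
  have "\<exists>u. u \<in> hom C (A (Suc n)) (A (Suc (Suc n))) \<and>
      (\<forall>i\<le>Suc (Suc n). d (Suc (Suc n)) i \<cdot> u = degen_face (Suc n) \<sigma> j i)"
    if j: "j \<le> Suc n" for j
  proof -
    have "degen_face (Suc n) \<sigma> j i \<in> hom C (A (Suc n)) (A (Suc n))" if "i \<le> Suc (Suc n)" for i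
      using that j obj Ident_hom Comp_hom[OF face_hom \<sigma>_hom] by (auto simp: degen_face_def)
    moreover have "d (Suc n) i \<cdot> degen_face (Suc n) \<sigma> j k =
        d (Suc n) (k - 1) \<cdot> degen_face (Suc n) \<sigma> j i"
      if ik: "i < k" "k \<le> Suc (Suc n)" for i k
    proof -
      have f: "d (Suc n) l \<in> hom C (A (Suc n)) (A n)" if "l \<le> Suc n" for l
        using that by (rule face_hom)
      have ff: "d n l \<cdot> d (Suc n) h = d n (h - 1) \<cdot> d (Suc n) l" if "l < h" "h \<le> Suc n" "n \<noteq> 0" for l h
        using that face_face[of l h "n - 1"] by simp
      \<comment> \<open>The cases place \<open>i < k\<close> relative to \<open>j\<close> and
        \<open>Suc j\<close>. If one index falls into this pair, a face cancels a degeneracy; if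
        both do, the two sides coincide; if neither does, both faces move past the degeneracy and a
        face identity one level down remains.\<close>
      consider (a) "k < j" | (b) "i < j" "j \<le> k" "k \<le> Suc j" | (c) "i < j" "Suc j < k"
        | (d) "i = j" "k = Suc j" | (e) "j \<le> i" "i \<le> Suc j" "Suc j < k" | (f) "Suc j < i"
        using ik(1) by linarith
      then show ?thesis
      proof cases
        case a
        have "d (Suc n) i \<cdot> (\<sigma> (j - 1) \<cdot> d (Suc n) k) = \<tau> (j - 1 - 1) \<cdot> (d n i \<cdot> d (Suc n) k)"
          using a ik j by (intro lo[OF f]) auto
        also have "\<dots> = \<tau> (j - 1 - 1) \<cdot> (d n (k - 1) \<cdot> d (Suc n) i)"
          using ff[of i k] a ik j by simp
        also have "\<dots> = d (Suc n) (k - 1) \<cdot> (\<sigma> (j - 1) \<cdot> d (Suc n) i)"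
          using a ik j by (intro lo[OF f, symmetric]) auto
        finally show ?thesis using a ik by (simp add: degen_face_def)
      next
        case b
        have "d (Suc n) (k - 1) \<cdot> (\<sigma> (j - 1) \<cdot> d (Suc n) i) = d (Suc n) i"
          using b ik j by (intro id[OF f]) auto
        moreover have "d (Suc n) i \<cdot> Ident C (A (Suc n)) = d (Suc n) i"
          using b j by (intro Ident_right[OF f]) auto
        ultimately show ?thesis using b by (simp add: degen_face_def)
      next
        case c
        have "d (Suc n) i \<cdot> (\<sigma> j \<cdot> d (Suc n) (k - 1)) = \<tau> (j - 1) \<cdot> (d n i \<cdot> d (Suc n) (k - 1))"
          using c ik j by (intro lo[OF f]) auto
        also have "\<dots> = \<tau> (j - 1) \<cdot> (d n (k - 1 - 1) \<cdot> d (Suc n) i)"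
          using ff[of i "k - 1"] c ik j by simp
        also have "\<dots> = d (Suc n) (k - 1) \<cdot> (\<sigma> (j - 1) \<cdot> d (Suc n) i)"
          using c ik j by (intro hi[OF f, symmetric]) auto
        finally show ?thesis using c ik by (simp add: degen_face_def)
      next
        case d
        then show ?thesis by (simp add: degen_face_def)
      next
        case e
        have "d (Suc n) i \<cdot> (\<sigma> j \<cdot> d (Suc n) (k - 1)) = d (Suc n) (k - 1)"
          using e ik j by (intro id[OF f]) auto
        moreover have "d (Suc n) (k - 1) \<cdot> Ident C (A (Suc n)) = d (Suc n) (k - 1)"
          using e ik j by (intro Ident_right[OF f]) auto
        ultimately show ?thesis using e by (simp add: degen_face_def)
      next
        case f': f
        have "d (Suc n) i \<cdot> (\<sigma> j \<cdot> d (Suc n) (k - 1)) = \<tau> j \<cdot> (d n (i - 1) \<cdot> d (Suc n) (k - 1))"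
          using f' ik j by (intro hi[OF f]) auto
        also have "\<dots> = \<tau> j \<cdot> (d n (k - 1 - 1) \<cdot> d (Suc n) (i - 1))"
          using ff[of "i - 1" "k - 1"] f' ik j by simp
        also have "\<dots> = d (Suc n) (k - 1) \<cdot> (\<sigma> j \<cdot> d (Suc n) (i - 1))"
          using f' ik j by (intro hi[OF f, symmetric]) auto
        finally show ?thesis using f' ik by (simp add: degen_face_def)
      qed
    qed
    ultimately show ?thesis
      using kernel_lift[of n "degen_face (Suc n) \<sigma> j" "A (Suc n)"] by metis
  qed
  then obtain \<rho> where "\<And>j. j \<le> Suc n \<Longrightarrow> \<rho> j \<in> hom C (A (Suc n)) (A (Suc (Suc n))) \<and>
      (\<forall>i\<le>Suc (Suc n). d (Suc (Suc n)) i \<cdot> \<rho> j = degen_face (Suc n) \<sigma> j i)"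
    by metis
  then have "degens (Suc n) \<sigma> \<rho>" using \<sigma>_hom by (simp add: degens_def)
  then show thesis by (rule that)
qed

lemma quasi_simplicial_coskeleton: "\<exists>s. quasi_simplicial C A d s"
proof -
  \<comment> \<open>Stages are pairs because each choice depends on the previous one: the
    degeneracies chosen at stage \<open>n\<close> become the lower ones at stage
    \<open>Suc n\<close>.\<close>
  have "\<exists>F. \<forall>n. degens n (fst (F n)) (snd (F n)) \<and> fst (F (Suc n)) = snd (F n)"
  proof (rule dependent_nat_choice)
    show "\<exists>x. degens 0 (fst x) (snd x)" using degens_0 by auto
    show "\<exists>y. degens (Suc n) (fst y) (snd y) \<and> fst y = snd x" if "degens n (fst x) (snd x)" for x n
      using degens_Suc[OF that] by (metis fst_conv snd_conv)
  qed
  then obtain F where F: "\<And>n. degens n (fst (F n)) (snd (F n))" "\<And>n. fst (F (Suc n)) = snd (F n)"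
    by blast
  define s where "s n = snd (F n)" for n
  have s: "s n j \<in> hom C (A n) (A (n + 1))"
    "i \<le> n + 1 \<Longrightarrow> d (n + 1) i \<cdot> s n j = degen_face n (s (n - 1)) j i" if "j \<le> n" for n i j
  proof -
    show "s n j \<in> hom C (A n) (A (n + 1))" using F(1)[of n] that by (simp add: degens_def s_def)
    assume i: "i \<le> n + 1"
    show "d (n + 1) i \<cdot> s n j = degen_face n (s (n - 1)) j i"
    proof (cases n)
      \<comment> \<open>Here \<open>n - 1\<close> is again \<open>0\<close>, harmlessly, since
        \<open>degen_face 0\<close> only yields identities in this range.\<close>
      case 0
      then show ?thesis using F(1)[of 0] that i by (simp add: degens_def s_def degen_face_def)
    next
      case (Suc m)
      then show ?thesis using F(1)[of n] F(2)[of m] that i by (simp add: degens_def s_def)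
    qed
  qed
  have "quasi_simplicial C A d s"
    unfolding quasi_simplicial_def
  proof (intro conjI allI impI)
    show "semi_simplicial C A d" by (rule semi)
    show "s n i \<in> hom C (A n) (A (n + 1))" if "i \<le> n" for n i using s(1) that .
    fix n i j :: nat
    assume ij: "i \<le> n + 1 \<and> j \<le> n"
    show "d (n + 1) i \<cdot> s n j = s (n - 1) (j - 1) \<cdot> d n i" if "i < j"
      using s(2)[of j n i] ij that by (simp add: degen_face_def)
    show "d (n + 1) i \<cdot> s n j = Ident C (A n)" if "i = j \<or> i = j + 1"
      using s(2)[of j n i] ij that by (auto simp: degen_face_def)
    show "d (n + 1) i \<cdot> s n j = s (n - 1) j \<cdot> d n (i - 1)" if "i > j + 1"
      using s(2)[of j n i] ij that by (simp add: degen_face_def)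
  qed
  then show ?thesis by blast
qed

text \<open>The relations between the degeneracies come for free, because the faces out of each
  \<open>A (n + 2)\<close> are jointly monic.\<close>

lemma simplicial_coskeleton: "\<exists>s. simplicial C A d s"
proof -
  obtain s where "quasi_simplicial C A d s" using quasi_simplicial_coskeleton by blast
  then interpret quasi_simplicial_object C A d s by unfold_locales
  have "s (Suc n) i \<cdot> s n j = s (Suc n) (Suc j) \<cdot> s n i" if "i \<le> j" "j \<le> n" for n i j
    using that
  proof (induction n arbitrary: i j rule: less_induct)
    case (less n)
    note i = \<open>i \<le> j\<close> and j = \<open>j \<le> n\<close>
    \<comment> \<open>The induction hypothesis one dimension down, precomposed with a face: the form
      that arises once a face has moved past both degeneracies.\<close>
    have IH: "s n i' \<cdot> (s (n - 1) j' \<cdot> d n k) = s n (Suc j') \<cdot> (s (n - 1) i' \<cdot> d n k)"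
      if ij: "i' \<le> j'" "j' < n" "k \<le> n" for i' j' k
    proof -
      obtain p where p: "n = Suc p" using ij(2) by (cases n) auto
      have "s n i' \<cdot> s p j' = s n (Suc j') \<cdot> s p i'"
        using less.IH[of p i' j'] ij p by simp
      then show ?thesis
        using square_precomp[OF _ degen_hom[of j' p] degen_hom[of i' "Suc p"] degen_hom[of i' p]
            degen_hom[of "Suc j'" "Suc p"] face_hom[of k p]] ij p by simp
    qed
    have si: "s n i \<in> hom C (A n) (A (Suc n))" and sj: "s n j \<in> hom C (A n) (A (Suc n))"
      using i j by (simp_all add: degen_hom)
    show ?case
    proof (rule kernel_eqI)
      show "s (Suc n) i \<cdot> s n j \<in> hom C (A n) (A (Suc (Suc n)))"
        "s (Suc n) (Suc j) \<cdot> s n i \<in> hom C (A n) (A (Suc (Suc n)))"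
        using degen_comp[OF sj] degen_comp[OF si] i j by simp_all
      fix k assume k: "k \<le> Suc (Suc n)"
      let ?l = "d (Suc (Suc n)) k \<cdot> (s (Suc n) i \<cdot> s n j)"
      let ?r = "d (Suc (Suc n)) k \<cdot> (s (Suc n) (Suc j) \<cdot> s n i)"
      \<comment> \<open>Face \<open>k\<close> passes the outer degeneracy on the left from below,
        cancels it, or passes it from above; in the last case its position relative to the inner
        degeneracy still matters.\<close>
      consider (a) "k < i" | (b) "i \<le> k" "k \<le> Suc i" | (c) "Suc i < k" by linarith
      then show "?l = ?r"
      proof cases
        case a
        obtain i' where i': "i = Suc i'" using a by (cases i) auto
        obtain j' where j': "j = Suc j'" using a i by (cases j) auto
        have "?l = s n i' \<cdot> (d (Suc n) k \<cdot> s n j)"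
          using face_degen_elem_less[OF sj, of i' k] a i j i' by simp
        also have "\<dots> = s n i' \<cdot> (s (n - 1) j' \<cdot> d n k)"
          using face_degen(1)[OF j, of k] a i j' by simp
        also have "\<dots> = s n j \<cdot> (s (n - 1) i' \<cdot> d n k)"
          using IH[of i' j' k] a i j i' j' by simp
        also have "\<dots> = s n j \<cdot> (d (Suc n) k \<cdot> s n i)"
          using face_degen(1)[of i n k] a i j i' by simp
        also have "\<dots> = ?r"
          using face_degen_elem_less[OF si, of j k] a i j by simp
        finally show ?thesis .
      next
        case b
        have ki: "k = i \<or> k = Suc i" using b by linarith
        then have "?l = s n j" using face_degen_elem_eq[OF sj, of i k] i j by simp
        also have "\<dots> = ?r"
        proof (cases "k \<le> j")
          case True
          have "?r = s n j \<cdot> (d (Suc n) k \<cdot> s n i)"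
            using face_degen_elem_less[OF si j True] .
          also have "\<dots> = s n j"
            using face_degen(2)[of i n k] ki i j Ident_right[OF sj] by simp
          finally show ?thesis by simp
        next
          case False
          then have "k = Suc j" "i = j" using b i by auto
          then show ?thesis using face_degen_elem_eq[OF si, of "Suc j" k] j by simp
        qed
        finally show ?thesis .
      next
        case c
        then obtain h where h: "k = Suc h" by (cases k) auto
        have l: "?l = s n i \<cdot> (d (Suc n) h \<cdot> s n j)"
          using face_degen_elem_greater[OF sj, of i h] c k h by simp
        consider (lt) "h < j" | (eq) "j \<le> h" "h \<le> Suc j" | (gt) "Suc j < h" by linarith
        then show ?thesis
        proof cases
          case lt
          obtain j' where j': "j = Suc j'" using lt by (cases j) auto
          have "?l = s n i \<cdot> (s (n - 1) j' \<cdot> d n h)"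
            using l face_degen(1)[OF j lt] j' by simp
          also have "\<dots> = s n j \<cdot> (s (n - 1) i \<cdot> d n h)"
            using IH[of i j' h] lt c h j j' by simp
          also have "\<dots> = s n j \<cdot> (d (Suc n) k \<cdot> s n i)"
            using face_degen(3)[of i n k] c i j h lt by simp
          also have "\<dots> = ?r"
            using face_degen_elem_less[OF si j, of k] lt h by simp
          finally show ?thesis .
        next
          case eq
          have hj: "h = j \<or> h = Suc j" using eq by linarith
          then have "?l = s n i"
            using l face_degen(2)[OF j, of h] Ident_right[OF si] by simp
          also have "\<dots> = ?r"
            using face_degen_elem_eq[OF si, of "Suc j" k] hj h j by simp
          finally show ?thesis .
        next
          case gt
          have "?l = s n i \<cdot> (s (n - 1) j \<cdot> d n (h - 1))"
            using l face_degen(3)[OF j gt] k h by simp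
          also have "\<dots> = s n (Suc j) \<cdot> (s (n - 1) i \<cdot> d n (h - 1))"
            using IH[of i j "h - 1"] gt k h i by simp
          also have "\<dots> = s n (Suc j) \<cdot> (d (Suc n) h \<cdot> s n i)"
            using face_degen(3)[of i n h] gt k h i j by simp
          also have "\<dots> = ?r"
            using face_degen_elem_greater[OF si, of "Suc j" h] gt k h by simp
          finally show ?thesis .
        qed
      qed
    qed
  qed
  then have "simplicial C A d s" using quasi by (simp add: simplicial_def)
  then show ?thesis by blast
qed

end

lemma (in category) reflexive_graph_coskeleton:
  assumes "has_simplicial_kernels C" and e: "e0 \<in> hom C G Z" "e1 \<in> hom C G Z"
    and r: "r \<in> hom C Z G" "e0 \<cdot> r = Ident C Z" "e1 \<cdot> r = Ident C Z"
  obtains A d s where "simplicial C A d s" "A 0 = Z" "A (Suc 0) = G"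
    "d (Suc 0) 0 = e0" "d (Suc 0) (Suc 0) = e1"
proof -
  \<comment> \<open>A stage consists of two consecutive objects and the faces between them;
    \<open>Q\<close> makes the next stage start at the upper object with a simplicial kernel. Hence
    the faces out of \<open>A (Suc n)\<close> sit in stage \<open>n\<close>, and \<open>d 0\<close>
    is only a filler value.\<close>
  define P where "P n x \<longleftrightarrow> (case x of (X, Y, f) \<Rightarrow> (\<forall>i\<le>Suc n. f i \<in> hom C Y X) \<and>
      (n = 0 \<longrightarrow> X = Z \<and> Y = G \<and> f 0 = e0 \<and> f (Suc 0) = e1))" for n and x :: "'o \<times> 'o \<times> (nat \<Rightarrow> 'm)"
  define Q where "Q n x y \<longleftrightarrow> (case x of (X, Y, f) \<Rightarrow> case y of (X', Y', f') \<Rightarrow>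
      X' = Y \<and> is_simplicial_kernel C (Suc n) Y f Y' f')" for n and x y :: "'o \<times> 'o \<times> (nat \<Rightarrow> 'm)"
  have "\<exists>F. \<forall>n. P n (F n) \<and> Q n (F n) (F (Suc n))"
  proof (rule dependent_nat_choice)
    have "P 0 (Z, G, \<lambda>i. if i = 0 then e0 else e1)" using e by (simp add: P_def)
    then show "\<exists>x. P 0 x" by blast
    fix x n assume "P n x"
    obtain X Y f where x: "x = (X, Y, f)" by (cases x)
    have f: "\<forall>i\<le>Suc n. f i \<in> hom C Y X" using \<open>P n x\<close> by (simp add: P_def x)
    then have "Y \<in> Obj C" "X \<in> Obj C" using hom_Obj by blast+
    then obtain K k where k: "is_simplicial_kernel C (Suc n) Y f K k"
      using assms(1) f unfolding has_simplicial_kernels_def by blast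
    then have "P (Suc n) (Y, K, k)"
      by (simp add: P_def is_simplicial_kernel_def simplicial_cone_def)
    moreover have "Q n x (Y, K, k)" using k by (simp add: Q_def x)
    ultimately show "\<exists>y. P (Suc n) y \<and> Q n x y" by blast
  qed
  then obtain F where F: "\<And>n. P n (F n)" "\<And>n. Q n (F n) (F (Suc n))" by blast
  define A where "A n = fst (F n)" for n
  define d where "d n = snd (snd (F (n - 1)))" for n
  have A_Suc: "A (Suc n) = fst (snd (F n))" for n
    using F(2)[of n] by (auto simp: Q_def A_def split: prod.splits)
  have base: "A 0 = Z" "A (Suc 0) = G" "d (Suc 0) 0 = e0" "d (Suc 0) (Suc 0) = e1"
    using F(1)[of 0] by (auto simp: P_def A_def A_Suc[unfolded A_def] d_def split: prod.splits)
  interpret coskeletal_object C A d r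
  proof unfold_locales
    show "d (Suc 0) i \<in> hom C (A (Suc 0)) (A 0)" "d (Suc 0) i \<cdot> r = Ident C (A 0)" if "i \<le> Suc 0" for i
      using that e r base by (auto simp: le_Suc_eq)
    show "r \<in> hom C (A 0) (A (Suc 0))" using r base by simp
    show "is_simplicial_kernel C (Suc n) (A (Suc n)) (d (Suc n)) (A (Suc (Suc n))) (d (Suc (Suc n)))" for n
      using F(2)[of n] by (simp add: Q_def A_Suc d_def case_prod_beta)
  qed
  obtain s where "simplicial C A d s" using simplicial_coskeleton by blast
  then show thesis using base by (rule that)
qed

section \<open>From the Kan condition to (E5)\<close>

context extensions
begin

text \<open>Morphisms into \<open>G\<close> correspond to triples \<open>(x, y, z)\<close> with \<open>a x = a y\<close> and
  \<open>f y = f z\<close>, possibly not uniquely.\<close>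

lemma zigzag_object:
  assumes a: "a \<in> hom C X Y" "a \<in> E" and f: "f \<in> hom C X Z" "f \<in> E"
  obtains G u v w where "u \<in> hom C G X" "v \<in> hom C G X" "w \<in> hom C G X"
    "a \<cdot> u = a \<cdot> v" "f \<cdot> v = f \<cdot> w"
    "\<And>L x y z. x \<in> hom C L X \<Longrightarrow> y \<in> hom C L X \<Longrightarrow> z \<in> hom C L X \<Longrightarrow> a \<cdot> x = a \<cdot> y \<Longrightarrow>
      f \<cdot> y = f \<cdot> z \<Longrightarrow> \<exists>g \<in> hom C L G. u \<cdot> g = x \<and> v \<cdot> g = y \<and> w \<cdot> g = z"
proof -
  have a': "a \<in> Arr C" "Dom C a = X" "Cod C a = Y" and f': "f \<in> Arr C" "Dom C f = X" "Cod C f = Z"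
    using a f by (auto simp: hom_def)
  \<comment> \<open>Two successive pullbacks of morphisms in \<open>E\<close>: the kernel pair
    \<open>R\<close> of \<open>a\<close> encodes \<open>(x, y)\<close>, and pulling back
    \<open>f\<close> then adjoins \<open>z\<close>.\<close>
  obtain R r1 r2 where R: "is_pullback C a a R r1 r2"
    and r: "r1 \<in> hom C R X" "r2 \<in> hom C R X" "a \<cdot> r1 = a \<cdot> r2"
    using pullback_of_E[OF a a(1)] by blast
  have fr: "f \<cdot> r2 \<in> hom C R Z" using r f Comp_hom by blast
  obtain G w g where G: "is_pullback C f (f \<cdot> r2) G w g"
    and w: "w \<in> hom C G X" "g \<in> hom C G R" "f \<cdot> w = (f \<cdot> r2) \<cdot> g"
    using pullback_of_E[OF f fr] by blast
  show thesis
  proof (rule that)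
    show "r1 \<cdot> g \<in> hom C G X" "r2 \<cdot> g \<in> hom C G X" "w \<in> hom C G X"
      using r w Comp_hom by blast+
    show "a \<cdot> (r1 \<cdot> g) = a \<cdot> (r2 \<cdot> g)"
      using square_precomp[OF r(3) r(1) a(1) r(2) a(1) w(2)] .
    show "f \<cdot> (r2 \<cdot> g) = f \<cdot> w"
      using w(3) hom_assoc[OF w(2) r(2) f(1)] by simp
    fix L x y z
    assume xyz: "x \<in> hom C L X" "y \<in> hom C L X" "z \<in> hom C L X" "a \<cdot> x = a \<cdot> y" "f \<cdot> y = f \<cdot> z"
    obtain h where h: "h \<in> hom C L R" "r1 \<cdot> h = x" "r2 \<cdot> h = y"
      using is_pullback_lift[OF R, of x L y] xyz a' by auto
    have "f \<cdot> z = (f \<cdot> r2) \<cdot> h"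
      using xyz(5) h(3) hom_assoc[OF h(1) r(2) f(1)] by simp
    then obtain k where k: "k \<in> hom C L G" "w \<cdot> k = z" "g \<cdot> k = h"
      using is_pullback_lift[OF G, of z L h] xyz(3) h(1) f' fr by (auto simp: hom_def)
    have "(r1 \<cdot> g) \<cdot> k = x" "(r2 \<cdot> g) \<cdot> k = y"
      using hom_assoc[OF k(1) w(2) r(1)] hom_assoc[OF k(1) w(2) r(2)] k(3) h by simp_all
    then show "\<exists>k \<in> hom C L G. (r1 \<cdot> g) \<cdot> k = x \<and> (r2 \<cdot> g) \<cdot> k = y \<and> w \<cdot> k = z"
      using k by blast
  qed
qed

text \<open>By (E4) it suffices to find some \<open>v'\<close> with \<open>c \<cdot> v'\<close> in
  \<open>E\<close>. The composite will be \<open>y \<cdot> t2\<close>, where \<open>y\<close> and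
  \<open>t2\<close> are pullbacks of morphisms in \<open>E\<close>.\<close>

lemma comparison_in_E_if_simplicial_Kan:
  assumes kernels: "has_simplicial_kernels C" and Kan: "\<forall>A d s. simplicial C A d s \<longrightarrow> Kan C E A d"
    and sq: "split_epi_of_extensions C E a b f1 f0 s1 s0" and f1E: "f1 \<in> E"
    and P: "is_pullback C f0 b P p q"
    and c: "c \<in> hom C (Dom C a) P" "p \<cdot> c = a" "q \<cdot> c = f1"
  shows "c \<in> E"
proof -
  define X where "X = Dom C a"
  define Y where "Y = Dom C b"
  define X0 where "X0 = Cod C a"
  define Y0 where "Y0 = Cod C b"
  have a: "a \<in> hom C X X0" "a \<in> E" and b: "b \<in> hom C Y Y0"
    and f: "f1 \<in> hom C X Y" "f0 \<in> hom C X0 Y0" and fa: "f0 \<cdot> a = b \<cdot> f1"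
    and s: "s1 \<in> hom C Y X" "s0 \<in> hom C Y0 X0" and as: "a \<cdot> s1 = s0 \<cdot> b"
    and fs: "f1 \<cdot> s1 = Ident C Y"
    using sq
    by (simp_all add: split_epi_of_extensions_def commutative_square_def X_def Y_def X0_def Y0_def hom_def)
  have p: "p \<in> hom C P X0" and q: "q \<in> hom C P Y" and pq: "f0 \<cdot> p = b \<cdot> q"
    using is_pullback_square[OF P] f b by (auto simp: hom_def)
  have c: "c \<in> hom C X P" "p \<cdot> c = a" "q \<cdot> c = f1" using c by (simp_all add: X_def)
  obtain G u v w where uvw: "u \<in> hom C G X" "v \<in> hom C G X" "w \<in> hom C G X"
    "a \<cdot> u = a \<cdot> v" "f1 \<cdot> v = f1 \<cdot> w"
    and G: "\<And>L x y z. x \<in> hom C L X \<Longrightarrow> y \<in> hom C L X \<Longrightarrow> z \<in> hom C L X \<Longrightarrow> a \<cdot> x = a \<cdot> y \<Longrightarrow>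
      f1 \<cdot> y = f1 \<cdot> z \<Longrightarrow> \<exists>g \<in> hom C L G. u \<cdot> g = x \<and> v \<cdot> g = y \<and> w \<cdot> g = z"
    by (rule zigzag_object[OF a f(1) f1E]) (rule that)
  \<comment> \<open>The constant triple \<open>(1, 1, 1)\<close> gives the common section of
    \<open>u\<close> and \<open>w\<close>.\<close>
  have "Ident C X \<in> hom C X X" using hom_Obj(1)[OF a(1)] by (rule Ident_hom)
  from G[OF this this this] obtain r where r: "r \<in> hom C X G" "u \<cdot> r = Ident C X" "w \<cdot> r = Ident C X"
    by auto
  \<comment> \<open>The outer components \<open>w\<close> and \<open>u\<close> are the faces of an
    edge. The middle component \<open>v\<close> is not visible in the endpoints; it is what a filler
    will produce.\<close>
  obtain A d s where A: "simplicial C A d s" "A 0 = X" "A (Suc 0) = G"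
    "d (Suc 0) 0 = w" "d (Suc 0) (Suc 0) = u"
    using reflexive_graph_coskeleton[OF kernels uvw(3,1) r(1,3,2)] by blast
  interpret semi_simplicial_object C A d
    using A(1) by unfold_locales (simp add: simplicial_def quasi_simplicial_def)
  have d: "d 2 i \<in> hom C (A 2) G" if "i \<le> 2" for i
    using face_hom[of i "Suc 0"] that A(3) by (simp add: numeral_2_eq_2)
  have dd: "w \<cdot> d 2 1 = w \<cdot> d 2 0" "w \<cdot> d 2 2 = u \<cdot> d 2 0" "u \<cdot> d 2 2 = u \<cdot> d 2 1"
    using face_face[of 0 1 0] face_face[of 0 2 0] face_face[of 1 2 0] A
    by (simp_all add: numeral_2_eq_2)
  have "Kan C E A d" using Kan A(1) by blast
  then have "(\<exists>H h. is_horn_object C A d 2 0 H h) \<and>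
      (\<forall>H h e. is_horn_object C A d 2 0 H h \<and> e \<in> hom C (A 2) H \<and>
        (\<forall>i. i \<le> 2 \<and> i \<noteq> 0 \<longrightarrow> h i \<cdot> e = d 2 i) \<longrightarrow> e \<in> E)"
    unfolding Kan_def by blast
  then obtain H h where H: "is_horn_object C A d 2 0 H h"
    and HE: "\<And>e. e \<in> hom C (A 2) H \<Longrightarrow> (\<And>i. i \<le> 2 \<Longrightarrow> i \<noteq> 0 \<Longrightarrow> h i \<cdot> e = d 2 i) \<Longrightarrow> e \<in> E"
    by blast
  \<comment> \<open>A \<open>(2, 0)\<close>-horn is a pair of edges with the same
    \<open>u\<close>-end, from the identity for the faces 1 and 2.\<close>
  have horn_lift: "\<exists>e \<in> hom C L H. h 1 \<cdot> e = x \<and> h 2 \<cdot> e = y"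
    if "x \<in> hom C L G" "y \<in> hom C L G" "u \<cdot> y = u \<cdot> x" for L x y
  proof -
    have "horn_cone C A d 2 0 L (\<lambda>i. if i = 1 then x else y)"
      unfolding horn_cone_def
    proof (intro conjI allI impI)
      show "L \<in> Obj C" using that(1) hom_Obj by blast
      show "(if i = 1 then x else y) \<in> hom C L (A (2 - 1))" for i
        using that A(3) by simp
      fix i j :: nat
      assume "i < j \<and> j \<le> 2 \<and> i \<noteq> 0 \<and> j \<noteq> 0"
      then have "i = 1" "j = 2" by auto
      then show "d (2 - 1) i \<cdot> (if j = 1 then x else y) = d (2 - 1) (j - 1) \<cdot> (if i = 1 then x else y)"
        using that(3) A(5) by simp
    qed
    then obtain e where e: "e \<in> hom C L H" "\<forall>i. i \<le> 2 \<and> i \<noteq> 0 \<longrightarrow> h i \<cdot> e = (if i = 1 then x else y)"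
      using H unfolding is_horn_object_def by blast
    have "h 1 \<cdot> e = x" "h 2 \<cdot> e = y" using e(2)[rule_format, of 1] e(2)[rule_format, of 2] by simp_all
    then show ?thesis using e(1) by blast
  qed
  have h: "h 1 \<in> hom C H G" "h 2 \<in> hom C H G"
    using H A(3) by (simp_all add: is_horn_object_def horn_cone_def)
  obtain k where k: "k \<in> hom C (A 2) H" "h 1 \<cdot> k = d 2 1" "h 2 \<cdot> k = d 2 2"
    using horn_lift[of "d 2 1" "A 2" "d 2 2"] d dd(3) by auto
  have "k \<in> E"
  proof (rule HE[OF k(1)])
    fix i :: nat assume "i \<le> 2" "i \<noteq> 0"
    then have "i = 1 \<or> i = 2" by linarith
    then show "h i \<cdot> k = d 2 i" using k by blast
  qed

  \<comment> \<open>On \<open>Q = {(x, y). a x = p y}\<close>, fill the \<open>(2, 0)\<close>-horn whose faces are the degenerate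
    edge at \<open>s1 q y\<close> and the edge \<open>(s1 q y, s1 f1 x, x)\<close>.  The middle component of the missing
    face is then a preimage of \<open>y\<close> under \<open>c\<close>.\<close>
  obtain Q x y where yE: "y \<in> E"
    and x: "x \<in> hom C Q X" and y: "y \<in> hom C Q P" and xy: "a \<cdot> x = p \<cdot> y"
    using pullback_of_E[OF a p] by blast
  define z where "z = s1 \<cdot> (q \<cdot> y)"
  define z' where "z' = s1 \<cdot> (f1 \<cdot> x)"
  have qy: "q \<cdot> y \<in> hom C Q Y" and f1x: "f1 \<cdot> x \<in> hom C Q Y"
    using q y f x Comp_hom by blast+
  have z: "z \<in> hom C Q X" and z': "z' \<in> hom C Q X"
    using qy f1x s Comp_hom by (auto simp: z_def z'_def)
  \<comment> \<open>Since \<open>a \<cdot> s1 = s0 \<cdot> b\<close>, equal images under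
    \<open>b\<close> give equal images of \<open>z\<close> and \<open>z'\<close> under
    \<open>a\<close>; the former come from the two squares and
    \<open>a \<cdot> x = p \<cdot> y\<close>.\<close>
  have "b \<cdot> (q \<cdot> y) = f0 \<cdot> (p \<cdot> y)"
    using square_precomp[OF pq p f(2) q b y] by simp
  also have "\<dots> = b \<cdot> (f1 \<cdot> x)"
    using square_precomp[OF fa a(1) f(2) f(1) b x] xy by simp
  finally have "b \<cdot> (q \<cdot> y) = b \<cdot> (f1 \<cdot> x)" .
  then have az: "a \<cdot> z = a \<cdot> z'"
    unfolding z_def z'_def
    using square_precomp[OF as s(1) a(1) b s(2) qy] square_precomp[OF as s(1) a(1) b s(2) f1x] by simp
  have fz: "f1 \<cdot> z = q \<cdot> y" and fz': "f1 \<cdot> z' = f1 \<cdot> x"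
    unfolding z_def z'_def
    using retract_precomp[OF fs s(1) f(1) qy] retract_precomp[OF fs s(1) f(1) f1x] by simp_all
  obtain e1 where e1: "e1 \<in> hom C Q G" "u \<cdot> e1 = z" "w \<cdot> e1 = z"
    using G[OF z z z] by auto
  obtain e2 where e2: "e2 \<in> hom C Q G" "u \<cdot> e2 = z" "w \<cdot> e2 = x"
    using G[OF z z' x az fz'] by auto
  obtain l where l: "l \<in> hom C Q H" "h 1 \<cdot> l = e1" "h 2 \<cdot> l = e2"
    using horn_lift[OF e1(1) e2(1)] e1(2) e2(2) by auto
  \<comment> \<open>\<open>k\<close> lies in \<open>E\<close> but need not split, so the horn
    \<open>l\<close> is filled only after pulling back to \<open>T\<close>; \<open>t1\<close> is the
    filler.\<close>
  obtain T t1 t2 where t2E: "t2 \<in> E"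
    and t: "t1 \<in> hom C T (A 2)" "t2 \<in> hom C T Q" "k \<cdot> t1 = l \<cdot> t2"
    using pullback_of_E[OF k(1) \<open>k \<in> E\<close> l(1)] by blast
  have dt: "d 2 1 \<cdot> t1 = e1 \<cdot> t2" "d 2 2 \<cdot> t1 = e2 \<cdot> t2"
    using hom_assoc[OF t(1) k(1) h(1)] hom_assoc[OF t(1) k(1) h(2)] k(2,3) t(3)
      hom_assoc[OF t(2) l(1) h(1)] hom_assoc[OF t(2) l(1) h(2)] l(2,3) by simp_all
  \<comment> \<open>The missing face has ends \<open>x\<close> and \<open>z\<close>, restricted
    along \<open>t2\<close>. Its middle component therefore shares its image under \<open>a\<close>
    with \<open>x\<close> and its image under \<open>f1\<close> with \<open>z\<close>, which are the
    two components of \<open>y\<close>.\<close>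
  define e0 where "e0 = d 2 0 \<cdot> t1"
  have e0: "e0 \<in> hom C T G" unfolding e0_def using t(1) d[of 0] Comp_hom by simp
  have "w \<cdot> e0 = w \<cdot> (e1 \<cdot> t2)"
    unfolding e0_def using square_precomp[OF dd(1) d uvw(3) d uvw(3) t(1)] dt(1) by simp
  then have we0: "w \<cdot> e0 = z \<cdot> t2" using hom_assoc[OF t(2) e1(1) uvw(3)] e1(3) by simp
  have "u \<cdot> e0 = w \<cdot> (e2 \<cdot> t2)"
    unfolding e0_def using square_precomp[OF dd(2) d uvw(3) d uvw(1) t(1)] dt(2) by simp
  then have ue0: "u \<cdot> e0 = x \<cdot> t2" using hom_assoc[OF t(2) e2(1) uvw(3)] e2(3) by simp
  define v' where "v' = v \<cdot> e0"
  have v': "v' \<in> hom C T X" unfolding v'_def using e0 uvw(2) Comp_hom by blast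
  have av': "a \<cdot> v' = p \<cdot> (y \<cdot> t2)"
    using square_precomp[OF uvw(4) uvw(1) a(1) uvw(2) a(1) e0] ue0
      square_precomp[OF xy x a(1) y p t(2)] by (simp add: v'_def)
  have fv': "f1 \<cdot> v' = q \<cdot> (y \<cdot> t2)"
    using square_precomp[OF uvw(5) uvw(2) f(1) uvw(3) f(1) e0] we0
      square_precomp[OF fz z f(1) y q t(2)] by (simp add: v'_def)
  have "c \<cdot> v' = y \<cdot> t2"
  proof (rule is_pullback_eqI[OF P])
    show "c \<cdot> v' \<in> hom C T P" "y \<cdot> t2 \<in> hom C T P" using c v' y t Comp_hom by blast+
    show "p \<cdot> (c \<cdot> v') = p \<cdot> (y \<cdot> t2)" using hom_assoc[OF v' c(1) p] c(2) av' by simp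
    show "q \<cdot> (c \<cdot> v') = q \<cdot> (y \<cdot> t2)" using hom_assoc[OF v' c(1) q] c(3) fv' by simp
  qed
  moreover have "y \<cdot> t2 \<in> E" using comp_in_E[OF t2E yE] t(2) y by (simp add: hom_def)
  ultimately show ?thesis
    using comp_in_E_cancel[of c v'] v' c(1) by (simp add: hom_def)
qed

text \<open>\<open>f1\<close> and \<open>f0\<close> are split, hence in \<open>E\<close>, and (E2)
  gives the pullback; only the comparison calls for the Kan condition.\<close>

lemma E5_if_simplicial_Kan:
  assumes "has_simplicial_kernels C" and "\<forall>A d s. simplicial C A d s \<longrightarrow> Kan C E A d"
  shows "E5 C E"
  unfolding E5_def
proof (intro allI impI)
  fix a b f1 f0 s1 s0
  assume sq: "split_epi_of_extensions C E a b f1 f0 s1 s0"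
  then have csq: "commutative_square C a b f1 f0" and ab: "a \<in> E" "b \<in> E"
    and f1: "f1 \<in> hom C (Dom C a) (Dom C b)" and f0: "f0 \<in> hom C (Cod C a) (Cod C b)"
    by (simp_all add: split_epi_of_extensions_def commutative_square_def)
  have f1E: "f1 \<in> E" and f0E: "f0 \<in> E"
    using split_epi_in_E[OF f1] split_epi_in_E[OF f0] sq
    by (auto simp: split_epi_of_extensions_def)
  have "b \<in> hom C (Dom C b) (Cod C b)"
    using csq by (simp add: commutative_square_def hom_def)
  from pullback_of_E[OF f0 f0E this] obtain P p q where "is_pullback C f0 b P p q"
    by blast
  then show "double_extension C E a b f1 f0"
    using csq ab f1E f0E comparison_in_E_if_simplicial_Kan[OF assms sq f1E]
    unfolding double_extension_def by blast
qed

end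

theorem theorem3p13:
  fixes C :: "('o, 'm, 'z) cat_scheme" and E :: "'m set"
  assumes "category C"
    and "has_simplicial_kernels C"
    and "E \<subseteq> Arr C"
    and "E1 C E" and "E2 C E" and "E3 C E" and "E4 C E"
  shows "(E5 C E \<longleftrightarrow> (\<forall>A d s. quasi_simplicial C A d s \<longrightarrow> Kan C E A d)) \<and>
         ((\<forall>A d s. quasi_simplicial C A d s \<longrightarrow> Kan C E A d) \<longleftrightarrow>
          (\<forall>A d s. simplicial C A d s \<longrightarrow> Kan C E A d))"
proof -
  interpret extensions C E
    using assms(1,3-7) by (intro extensions.intro extensions_axioms.intro)
  \<comment> \<open>The implications form the cycle (a) to (b) to (c) to (a).\<close>
  have "Kan C E A d" if "E5 C E" "quasi_simplicial C A d s" for A d s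
  proof -
    interpret quasi_simplicial_in_extensions C E A d s
      using that(2) by unfold_locales
    show ?thesis using that(1) by (rule Kan_if_E5)
  qed
  moreover have "quasi_simplicial C A d s" if "simplicial C A d s" for A d s
    using that by (simp add: simplicial_def)
  moreover have "E5 C E" if "\<forall>A d s. simplicial C A d s \<longrightarrow> Kan C E A d"
    using E5_if_simplicial_Kan[OF assms(2)] that by blast
  ultimately show ?thesis by blast
qed

end
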